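(* Let $\varphi(t)$ be a smooth one-parameter family of $G_2$-structures on a smooth 7-manifold $M$ evolving by the general flow $$\frac{\partial}{\partial t}\varphi_{ijk} = h^l_i\varphi_{ljk} + h^l_j\varphi_{ilk} + h^l_k\varphi_{ijl} + X^l\psi_{lijk},$$ where $h=h(t)$ is a symmetric 2-tensor, $X=X(t)$ is a vector field, and $h^l_i = g^{lm}h_{im}$. Then the dual 4-form $\psi=*\varphi$ evolves by $$\frac{\partial}{\partial t}\psi_{ijkl} = h^m_i\psi_{mjkl} + h^m_j\psi_{imkl} + h^m_k\psi_{ijml} + h^m_l\psi_{ijkm} - X_i\varphi_{jkl} + X_j\varphi_{ikl} - X_k\varphi_{ijl} + X_l\varphi_{ijk},$$ where $X_k = g_{kl}X^l$.
   Context: Index notation in local coordinates $x^1,\dots,x^7$, with the summation convention; forms are written $\alpha=\frac{1}{k!}\alpha_{i_1\cdots i_k}dx^{i_1}\wedge\cdots\wedge dx^{i_k}$. A $G_2$-structure on a smooth 7-manifold $M$ is a smooth 3-form $\varphi$ which at each point is equivalent, under a linear isomorphism $T_xM\cong\mathbb{R}^7$, to $e^{123}+e^{145}+e^{167}+e^{246}-e^{257}-e^{347}-e^{356}$. It determines a unique Riemannian metric $g$ and orientation (volume form $\mathsf{vol}$) by the convention $(u\lrcorner\varphi)\wedge(v\lrcorner\varphi)\wedge\varphi=-6\,g(u,v)\,\mathsf{vol}$. $*$ is the Hodge star of $g$ and this orientation. In the flow, $g$, $*$ and $\psi$ are those determined by $\varphi(t)$ at time $t$. *)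

theory Defs
  imports "HOL-Analysis.Analysis" "HOL-Combinatorics.Permutations"
begin

section \<open>Smooth maps\<close>

text \<open>For open sets \<^term>\<open>S\<close>: all iterated directional derivatives up to order \<^term>\<open>k\<close>
  exist and are continuous.\<close>

primrec Ck_on :: "nat \<Rightarrow> 'a::euclidean_space set \<Rightarrow> ('a \<Rightarrow> 'b::euclidean_space) \<Rightarrow> bool" where
  "Ck_on 0 S f \<longleftrightarrow> continuous_on S f"
| "Ck_on (Suc k) S f \<longleftrightarrow> (\<forall>x\<in>S. f differentiable (at x)) \<and>
     (\<forall>v. Ck_on k S (\<lambda>x. frechet_derivative f (at x) v))"

text \<open>On an arbitrary set, smooth means locally the restriction of a smooth map defined on an open
  set. This allows time intervals that contain an end point.\<close>

definition smooth_on :: "'a::euclidean_space set \<Rightarrow> ('a \<Rightarrow> 'b::euclidean_space) \<Rightarrow> bool" where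
  "smooth_on S f \<longleftrightarrow> (\<forall>x\<in>S. \<exists>W F. open W \<and> x \<in> W \<and> (\<forall>k. Ck_on k W F) \<and> (\<forall>y\<in>S \<inter> W. F y = f y))"


section \<open>Smooth manifolds\<close>

text \<open>A chart \<^term>\<open>(U, x)\<close> consists of its domain and its coordinate map. The map is only
  meaningful on \<^term>\<open>U\<close>.\<close>

type_synonym ('a, 'n) chart = "'a set \<times> ('a \<Rightarrow> real^'n)"

abbreviation chart_inv :: "('a, 'n) chart \<Rightarrow> real^'n \<Rightarrow> 'a" where
  "chart_inv c \<equiv> inv_into (fst c) (snd c)"

definition is_chart :: "'a topology \<Rightarrow> ('a, 'n::finite) chart \<Rightarrow> bool" where
  "is_chart M c \<longleftrightarrow> openin M (fst c) \<and> open (snd c ` fst c) \<and>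
     homeomorphic_map (subtopology M (fst c)) (top_of_set (snd c ` fst c)) (snd c)"

text \<open>The dimension of the manifold is \<^term>\<open>CARD('n)\<close>. The atlas need not be maximal.\<close>

definition smooth_manifold :: "'a topology \<Rightarrow> ('a, 'n::finite) chart set \<Rightarrow> bool" where
  "smooth_manifold M \<A> \<longleftrightarrow> Hausdorff_space M \<and> second_countable M \<and>
     (\<forall>c\<in>\<A>. is_chart M c) \<and> (\<Union>c\<in>\<A>. fst c) = topspace M \<and>
     (\<forall>c\<in>\<A>. \<forall>d\<in>\<A>. smooth_on (snd c ` (fst c \<inter> fst d)) (snd d \<circ> chart_inv c))"

text \<open>Row \<^term>\<open>j\<close>, column \<^term>\<open>i\<close> is the partial derivative at \<^term>\<open>p\<close> of the
  \<^term>\<open>j\<close>-th coordinate of \<^term>\<open>d\<close> by the \<^term>\<open>i\<close>-th coordinate of \<^term>\<open>c\<close>.\<close>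

definition jacobian :: "('a, 'n::finite) chart \<Rightarrow> ('a, 'n) chart \<Rightarrow> 'a \<Rightarrow> real^'n^'n" where
  "jacobian c d p = matrix (frechet_derivative (snd d \<circ> chart_inv c) (at (snd c p)))"


section \<open>Tensors and forms in components\<close>

text \<open>A covariant tensor at a point is given by its components in the coordinate basis:
  \<^term>\<open>\<alpha> [i\<^sub>1, i\<^sub>2, i\<^sub>3]\<close> is the component with these indices, in this order.
  A tensor of degree \<^term>\<open>k\<close> vanishes on index lists of any length other than \<^term>\<open>k\<close>.\<close>

type_synonym 'n tensor = "'n list \<Rightarrow> real"

definition has_degree :: "nat \<Rightarrow> 'n tensor \<Rightarrow> bool" where
  "has_degree k \<alpha> \<longleftrightarrow> (\<forall>I. length I \<noteq> k \<longrightarrow> \<alpha> I = 0)"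

definition alternating :: "'n tensor \<Rightarrow> bool" where
  "alternating \<alpha> \<longleftrightarrow>
     (\<forall>I \<sigma>. \<sigma> permutes {..<length I} \<longrightarrow> \<alpha> (permute_list \<sigma> I) = of_int (sign \<sigma>) * \<alpha> I)"

definition is_form :: "nat \<Rightarrow> 'n tensor \<Rightarrow> bool" where
  "is_form k \<alpha> \<longleftrightarrow> has_degree k \<alpha> \<and> alternating \<alpha>"

text \<open>The form \<open>dx\<^bsup>j\<^sub>1\<^esup> \<and> \<dots> \<and> dx\<^bsup>j\<^sub>k\<^esup>\<close>; its components are the
  determinants of the matrices of Kronecker deltas of the indices \<^term>\<open>J\<close> and \<^term>\<open>I\<close>.\<close>

definition dxs :: "'n list \<Rightarrow> 'n tensor" where
  "dxs J I = (\<Sum>\<sigma> | \<sigma> permutes {..<length J}. if I = permute_list \<sigma> J then of_int (sign \<sigma>) else 0)"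

text \<open>For a \<^term>\<open>k\<close>-form and an \<^term>\<open>l\<close>-form only one summand of the outer sum is nonzero,
  the antisymmetrised tensor product with factor \<open>1 / (k! l!)\<close>.\<close>

definition wedge :: "'n tensor \<Rightarrow> 'n tensor \<Rightarrow> 'n tensor" where
  "wedge \<alpha> \<beta> I = (\<Sum>k\<le>length I. (\<Sum>\<sigma> | \<sigma> permutes {..<length I}.
       of_int (sign \<sigma>) * \<alpha> (take k (permute_list \<sigma> I)) * \<beta> (drop k (permute_list \<sigma> I)))
     / (fact k * fact (length I - k)))"

definition interior_product :: "real^'n \<Rightarrow> 'n::finite tensor \<Rightarrow> 'n tensor" where
  "interior_product u \<alpha> I = (\<Sum>i\<in>UNIV. u $ i * \<alpha> (i # I))"

text \<open>Pullback along the linear map with matrix \<^term>\<open>A\<close>, that is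
  \<open>(A\<^sup>*\<alpha>)(v\<^sub>1, \<dots>, v\<^sub>k) = \<alpha>(A v\<^sub>1, \<dots>, A v\<^sub>k)\<close>.\<close>

definition pullback :: "real^'n^'n \<Rightarrow> 'n::finite tensor \<Rightarrow> 'n tensor" where
  "pullback A \<alpha> I = (\<Sum>J | length J = length I. (\<Prod>m<length I. A $ (J ! m) $ (I ! m)) * \<alpha> J)"


section \<open>Inner products and the Hodge star\<close>

definition inner_product_matrix :: "real^'n^'n::finite \<Rightarrow> bool" where
  "inner_product_matrix g \<longleftrightarrow> transpose g = g \<and> (\<forall>v. v \<noteq> 0 \<longrightarrow> v \<bullet> (g *v v) > 0)"

text \<open>All indices are raised with \<open>g\<^sup>-\<^sup>1\<close>.\<close>

definition raise_all :: "real^'n^'n \<Rightarrow> 'n::finite tensor \<Rightarrow> 'n tensor" where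
  "raise_all g \<alpha> I =
     (\<Sum>J | length J = length I. (\<Prod>m<length I. matrix_inv g $ (I ! m) $ (J ! m)) * \<alpha> J)"

text \<open>An orientation of a coordinate space is given by its sign \<^term>\<open>\<epsilon>\<close> (1 or -1) relative to the
  order \<open>x\<^sup>1, \<dots>, x\<^sup>7\<close> of the coordinates. In the index type \<^typ>\<open>7\<close> the numeral 7 denotes the
  same element as 0, so that \<^typ>\<open>7\<close> consists of the indices 1 to 7.\<close>

definition volume_form :: "real^7^7 \<Rightarrow> real \<Rightarrow> 7 tensor" where
  "volume_form g \<epsilon> I = \<epsilon> * sqrt (det g) * dxs [1, 2, 3, 4, 5, 6, 7] I"

text \<open>For a \<^term>\<open>k\<close>-form this is \<open>(*\<alpha>)\<^sub>J = 1/k! \<alpha>\<^sup>I vol\<^sub>I\<^sub>J\<close>, equivalently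
  \<open>\<beta> \<and> *\<alpha> = g(\<beta>, \<alpha>) vol\<close>.\<close>

definition hodge_star :: "real^7^7 \<Rightarrow> real \<Rightarrow> 7 tensor \<Rightarrow> 7 tensor" where
  "hodge_star g \<epsilon> \<alpha> J =
     (\<Sum>I | length I + length J = 7. raise_all g \<alpha> I * volume_form g \<epsilon> (I @ J)) / fact (7 - length J)"


section \<open>$G_2$-structures\<close>

definition model_3form :: "7 tensor" where
  "model_3form I = dxs [1,2,3] I + dxs [1,4,5] I + dxs [1,6,7] I + dxs [2,4,6] I
     - dxs [2,5,7] I - dxs [3,4,7] I - dxs [3,5,6] I"

definition G2_form :: "7 tensor \<Rightarrow> bool" where
  "G2_form \<phi> \<longleftrightarrow> is_form 3 \<phi> \<and> (\<exists>A. invertible A \<and> \<phi> = pullback A model_3form)"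

definition G2_induces :: "7 tensor \<Rightarrow> real^7^7 \<Rightarrow> real \<Rightarrow> bool" where
  "G2_induces \<phi> g \<epsilon> \<longleftrightarrow> inner_product_matrix g \<and> \<epsilon> \<in> {1, -1} \<and>
     (\<forall>u v. wedge (wedge (interior_product u \<phi>) (interior_product v \<phi>)) \<phi>
        = (\<lambda>I. - 6 * (u \<bullet> (g *v v)) * volume_form g \<epsilon> I))"

definition G2_metric :: "7 tensor \<Rightarrow> real^7^7" where
  "G2_metric \<phi> = (THE g. \<exists>\<epsilon>. G2_induces \<phi> g \<epsilon>)"

definition G2_orientation :: "7 tensor \<Rightarrow> real" where
  "G2_orientation \<phi> = (THE \<epsilon>. \<exists>g. G2_induces \<phi> g \<epsilon>)"

definition G2_dual :: "7 tensor \<Rightarrow> 7 tensor" where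
  "G2_dual \<phi> = hodge_star (G2_metric \<phi>) (G2_orientation \<phi>) \<phi>"


section \<open>Tensor fields\<close>

text \<open>A tensor or vector field is given by its components in every chart, subject to the
  transformation law under changes of coordinates.\<close>

type_synonym ('a, 'n) tensor_field = "('a, 'n) chart \<Rightarrow> 'a \<Rightarrow> 'n tensor"
type_synonym ('a, 'n) vec_field = "('a, 'n) chart \<Rightarrow> 'a \<Rightarrow> real^'n"

definition is_tensor_field ::
    "('a, 'n::finite) chart set \<Rightarrow> nat \<Rightarrow> ('a, 'n) tensor_field \<Rightarrow> bool" where
  "is_tensor_field \<A> k \<alpha> \<longleftrightarrow> (\<forall>c\<in>\<A>. \<forall>p\<in>fst c. has_degree k (\<alpha> c p)) \<and>
     (\<forall>c\<in>\<A>. \<forall>d\<in>\<A>. \<forall>p\<in>fst c \<inter> fst d. \<alpha> c p = pullback (jacobian c d p) (\<alpha> d p))"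

definition is_vec_field :: "('a, 'n::finite) chart set \<Rightarrow> ('a, 'n) vec_field \<Rightarrow> bool" where
  "is_vec_field \<A> X \<longleftrightarrow>
     (\<forall>c\<in>\<A>. \<forall>d\<in>\<A>. \<forall>p\<in>fst c \<inter> fst d. X d p = jacobian c d p *v X c p)"

text \<open>Families are required to be jointly smooth in time and coordinates.\<close>

definition smooth_tensor_family ::
    "('a, 'n::finite) chart set \<Rightarrow> real set \<Rightarrow> nat \<Rightarrow> (real \<Rightarrow> ('a, 'n) tensor_field) \<Rightarrow> bool" where
  "smooth_tensor_family \<A> T k \<alpha> \<longleftrightarrow> (\<forall>t\<in>T. is_tensor_field \<A> k (\<alpha> t)) \<and>
     (\<forall>c\<in>\<A>. \<forall>I. smooth_on (T \<times> snd c ` fst c) (\<lambda>(t, \<xi>). \<alpha> t c (chart_inv c \<xi>) I))"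

definition smooth_vec_family ::
    "('a, 'n::finite) chart set \<Rightarrow> real set \<Rightarrow> (real \<Rightarrow> ('a, 'n) vec_field) \<Rightarrow> bool" where
  "smooth_vec_family \<A> T X \<longleftrightarrow> (\<forall>t\<in>T. is_vec_field \<A> (X t)) \<and>
     (\<forall>c\<in>\<A>. smooth_on (T \<times> snd c ` fst c) (\<lambda>(t, \<xi>). X t c (chart_inv c \<xi>)))"

definition smooth_G2_family ::
    "('a, 7) chart set \<Rightarrow> real set \<Rightarrow> (real \<Rightarrow> ('a, 7) tensor_field) \<Rightarrow> bool" where
  "smooth_G2_family \<A> T \<phi> \<longleftrightarrow> smooth_tensor_family \<A> T 3 \<phi> \<and>
     (\<forall>t\<in>T. \<forall>c\<in>\<A>. \<forall>p\<in>fst c. G2_form (\<phi> t c p))"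

definition symmetric_2tensor_family ::
    "('a, 'n::finite) chart set \<Rightarrow> real set \<Rightarrow> (real \<Rightarrow> ('a, 'n) tensor_field) \<Rightarrow> bool" where
  "symmetric_2tensor_family \<A> T h \<longleftrightarrow> smooth_tensor_family \<A> T 2 h \<and>
     (\<forall>t\<in>T. \<forall>c\<in>\<A>. \<forall>p\<in>fst c. \<forall>i j. h t c p [i, j] = h t c p [j, i])"

text \<open>\<open>h\<^sup>l\<^sub>i = g\<^sup>l\<^sup>m h\<^sub>i\<^sub>m\<close> and \<open>X\<^sub>k = g\<^sub>k\<^sub>l X\<^sup>l\<close>.\<close>

definition mixed :: "real^'n^'n \<Rightarrow> 'n::finite tensor \<Rightarrow> 'n \<Rightarrow> 'n \<Rightarrow> real" where
  "mixed g h l i = (\<Sum>m\<in>UNIV. matrix_inv g $ l $ m * h [i, m])"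

definition lower :: "real^'n^'n \<Rightarrow> real^'n::finite \<Rightarrow> 'n \<Rightarrow> real" where
  "lower g X k = (\<Sum>l\<in>UNIV. g $ k $ l * X $ l)"

end

(* The general flow moves the 3-form infinitesimally by linear maps. Fix a point and a time t, and write
   phi(t) = A^* phi_0 with the model phi_0. A matrix acts on tensors as a derivation, and there is an
   explicit skew matrix H, linear in Y = A X, with H . phi_0 = Y _| psi_0 and H . psi_0 = - Y wedge phi_0. So
   phi(s) has the same first-order jet at s = t as the curve gamma(s) = (A + (s - t) K)^* phi_0 with
   K = A h + H A. The dual form is a differentiable function of the components of phi (the metric and the
   volume are recovered from the Gram matrix of phi by a ninth root), so the dual forms of phi(s) and
   gamma(s) have the same derivative at t. But the dual form of gamma(s) is (A + (s - t) K)^* psi_0, whose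
   derivative is h . psi + A^*(H . psi_0). *)
theory Submission
  imports Defs
begin

section \<open>Elementary forms\<close>

text \<open>Differentiating psi directly would require the variations of the metric, its inverse and
  the volume form, and the contraction identities between phi and psi. Naturality of the dual form
  under linear maps replaces all this by two identities for the model, which are linear in Y and so
  reduce to finite integer computations on the seven basis vectors. The matrix H is one third of Y^m
  phi_{mla}, up to sign the matrix of the cross product with Y; the third cancels the factor 3 in
  H_m . phi_0 = 3 e_m _| psi_0, where H_m has the entries phi_{mla}. The auxiliary curve is there
  because each phi(s) is a pullback of phi_0 by some matrix, but nothing makes these matrices depend
  differentiably on s. A straight line of matrices does, and it also exists on both sides of t when
  t is an end point of the time interval. On the model the wedge product that defines the metric is
  +6 times the inner product times dx^1...dx^7, while the convention has -6; hence the model carries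
  the orientation sign -1.\<close>

lemma permute_list_inj:
  assumes "\<tau> permutes {..<length I}" "length J = length I"
  shows "permute_list \<tau> I = permute_list \<tau> J \<longleftrightarrow> I = J"
proof
  assume eq: "permute_list \<tau> I = permute_list \<tau> J"
  have i: "inv \<tau> permutes {..<length I}" by (rule permutes_inv[OF assms(1)])
  have *: "permute_list (inv \<tau>) (permute_list \<tau> K) = K" if "length K = length I" for K :: "'a list"
    using permute_list_compose[of "inv \<tau>" K \<tau>] i that permutes_inv_o(1)[OF assms(1)] by simp
  have "I = permute_list (inv \<tau>) (permute_list \<tau> I)" by (rule *[symmetric]) simp
  also have "\<dots> = J" unfolding eq by (rule *[OF assms(2)])
  finally show "I = J" .
qed simp

lemma sign_mult_self_left: "(of_int (sign p) :: real) * (of_int (sign p) * x) = x"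
  by (simp add: sign_def)

lemma dxs_length: "length I \<noteq> length J \<Longrightarrow> dxs J I = 0"
  unfolding dxs_def by (rule sum.neutral) auto

lemma dxs_permute_left:
  assumes "\<tau> permutes {..<length J}"
  shows "dxs (permute_list \<tau> J) I = of_int (sign \<tau>) * dxs J I"
proof -
  have p: "permutation \<sigma>" if "\<sigma> permutes {..<length J}" for \<sigma>
    using that by (intro permutes_imp_permutation) auto
  \<comment> \<open>Permuting lists is a right action: in \<open>\<tau> \<circ> \<sigma>\<close> it
    is \<tau> that reaches \<open>J\<close> first, so composition on the left is the substitution
    needed.\<close>
  have "dxs J I = (\<Sum>\<sigma> | \<sigma> permutes {..<length J}.
      if I = permute_list (\<tau> \<circ> \<sigma>) J then of_int (sign (\<tau> \<circ> \<sigma>)) else 0)"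
    unfolding dxs_def by (rule setum_permutations_compose_left[OF assms])
  also have "\<dots> = (\<Sum>\<sigma> | \<sigma> permutes {..<length J}.
      of_int (sign \<tau>) * (if I = permute_list \<sigma> (permute_list \<tau> J) then of_int (sign \<sigma>) else 0))"
  proof (rule sum.cong[OF refl])
    fix \<sigma> assume "\<sigma> \<in> {\<sigma>. \<sigma> permutes {..<length J}}"
    then have \<sigma>: "\<sigma> permutes {..<length J}" by simp
    show "(if I = permute_list (\<tau> \<circ> \<sigma>) J then of_int (sign (\<tau> \<circ> \<sigma>)) else 0)
      = of_int (sign \<tau>) * (if I = permute_list \<sigma> (permute_list \<tau> J) then of_int (sign \<sigma>) else (0::real))"
      unfolding permute_list_compose[OF \<sigma>] sign_compose[OF p[OF assms] p[OF \<sigma>]] by simp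
  qed
  also have "\<dots> = of_int (sign \<tau>) * dxs (permute_list \<tau> J) I"
    by (simp add: dxs_def sum_distrib_left)
  finally show ?thesis by (simp add: sign_mult_self_left)
qed

text \<open>A matrix of Kronecker deltas and its transpose have the same determinant; in the Leibniz
  sum this is the substitution of the inverse permutation.\<close>

lemma dxs_sym: "dxs J I = dxs I J"
proof (cases "length I = length J")
  case True
  have *: "I = permute_list (inv \<sigma>) J \<longleftrightarrow> J = permute_list \<sigma> I" if "\<sigma> permutes {..<length J}" for \<sigma>
  proof -
    have "permute_list \<sigma> (permute_list (inv \<sigma>) J) = J"
      using permute_list_compose[of \<sigma> J "inv \<sigma>"] that permutes_inv_o(2)[OF that] by simp
    then show ?thesis using permute_list_inj[of \<sigma> I "permute_list (inv \<sigma>) J"] that True by auto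
  qed
  have p: "permutation \<sigma>" if "\<sigma> permutes {..<length J}" for \<sigma>
    using that by (intro permutes_imp_permutation) auto
  have "dxs J I = (\<Sum>\<sigma> | \<sigma> permutes {..<length J}.
      if I = permute_list (inv \<sigma>) J then of_int (sign (inv \<sigma>)) else 0)"
    unfolding dxs_def by (rule sum_permutations_inverse)
  also have "\<dots> = dxs I J"
  proof -
    have "(if I = permute_list (inv \<sigma>) J then of_int (sign (inv \<sigma>)) else (0::real))
      = (if J = permute_list \<sigma> I then of_int (sign \<sigma>) else 0)" if "\<sigma> permutes {..<length J}" for \<sigma>
      unfolding *[OF that] sign_inverse[OF p[OF that]] ..
    then show ?thesis unfolding dxs_def True by (intro sum.cong) auto
  qed
  finally show ?thesis .
qed (simp add: dxs_length)

lemma permute_list_swap: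
  fixes xs :: "'a list"
  defines "\<tau> \<equiv> Transposition.transpose (length xs) (Suc (length xs))"
  shows "\<tau> permutes {..<length (xs @ b # a # ys)}"
    and "permute_list \<tau> (xs @ b # a # ys) = xs @ a # b # ys"
    and "sign \<tau> = -1"
proof -
  show \<tau>: "\<tau> permutes {..<length (xs @ b # a # ys)}" for b a ys
    unfolding \<tau>_def by (rule permutes_swap_id) auto
  show "permute_list \<tau> (xs @ b # a # ys) = xs @ a # b # ys"
  proof (rule nth_equalityI)
    fix i assume "i < length (permute_list \<tau> (xs @ b # a # ys))"
    then show "permute_list \<tau> (xs @ b # a # ys) ! i = (xs @ a # b # ys) ! i"
      using \<tau>[of b a ys] by (subst permute_list_nth)
        (auto simp: \<tau>_def nth_append Transposition.transpose_def nth_Cons split: nat.split)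
  qed simp
  show "sign \<tau> = -1" by (simp add: \<tau>_def sign_swap_id)
qed

lemma dxs_swap: "dxs (xs @ a # b # ys) I = - dxs (xs @ b # a # ys) I"
  using dxs_permute_left[OF permute_list_swap(1), of xs b a ys I]
  by (simp add: permute_list_swap(2,3))

lemma dxs_Nil [simp]: "dxs [] [] = 1"
proof -
  have "{\<sigma>. \<sigma> permutes ({} :: nat set)} = {id}" by auto
  then show ?thesis by (simp add: dxs_def)
qed

section \<open>Expansion of an elementary form along its first index\<close>

lemma map_permutation_Suc_permute_list:
  assumes "q permutes {..<length J}"
  shows "permute_list (map_permutation {..<length J} Suc q) (a # J) = a # permute_list q J"
proof (rule nth_equalityI)
  let ?q = "map_permutation {..<length J} Suc q"
  have q: "?q permutes Suc ` {..<length J}"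
    by (rule map_permutation_permutes[OF _ assms]) (simp add: bij_betw_def)
  have q': "?q permutes {..<length (a # J)}"
    by (rule permutes_subset[OF q]) auto
  fix i assume "i < length (permute_list ?q (a # J))"
  then have i: "i < Suc (length J)" by simp
  show "permute_list ?q (a # J) ! i = (a # permute_list q J) ! i"
  proof (cases i)
    case 0
    then show ?thesis using permutes_not_in[OF q, of 0] q' by (simp add: permute_list_nth)
  next
    case (Suc j)
    then have "?q (Suc j) = Suc (q j)"
      using assms i by (intro map_permutation_apply) auto
    then show ?thesis using Suc i q' assms by (simp add: permute_list_nth)
  qed
qed simp

text \<open>Serves two changes of index set: the shift by \<open>Suc\<close> in the expansion along
  the first index, and the passage from list positions to the index type in the determinant.\<close>

lemma sum_permutations_map:
  assumes "bij_betw f A B"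
  shows "(\<Sum>p | p permutes B. F p) = (\<Sum>p | p permutes A. F (map_permutation A f p))"
proof -
  let ?g = "inv_into A f"
  have fg: "bij_betw ?g B A" by (rule bij_betw_inv_into[OF assms])
  show ?thesis
  proof (rule sum.reindex_bij_witness[of _ "map_permutation A f" "map_permutation B ?g"])
    fix p assume "p \<in> {p. p permutes B}"
    then have p: "p permutes B" by simp
    show "map_permutation A f (map_permutation B ?g p) = p"
      using assms by (intro map_permutation_compose_inv[OF fg p]) (simp add: bij_betw_inv_into_right)
    then show "F (map_permutation A f (map_permutation B ?g p)) = F p" by simp
    show "map_permutation B ?g p \<in> {p. p permutes A}" using map_permutation_permutes[OF fg p] by simp
  next
    fix p assume "p \<in> {p. p permutes A}"
    then have p: "p permutes A" by simp
    show "map_permutation B ?g (map_permutation A f p) = p"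
      using assms by (intro map_permutation_compose_inv[OF assms p]) (simp add: bij_betw_inv_into_left)
    show "map_permutation A f p \<in> {p. p permutes B}" using map_permutation_permutes[OF assms p] by simp
  qed
qed

lemma transpose_permutes_Cons:
  "b < length J \<Longrightarrow> Transposition.transpose 0 (Suc b) permutes {..<length (m # J)}"
  by (rule permutes_swap_id) auto

lemma permute_list_transpose_Cons:
  assumes b: "b < length J"
  shows "permute_list (Transposition.transpose 0 (Suc b)) (m # J) = J ! b # J[b := m]"
proof (rule nth_equalityI)
  fix k assume "k < length (permute_list (Transposition.transpose 0 (Suc b)) (m # J))"
  then show "permute_list (Transposition.transpose 0 (Suc b)) (m # J) ! k = (J ! b # J[b := m]) ! k"
    using transpose_permutes_Cons[OF b, of m] b
    by (auto simp: permute_list_nth Transposition.transpose_def nth_Cons nth_list_update split: nat.split)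
qed simp

text \<open>Laplace expansion, with the entry that is removed replaced by the first one, so that the
  remaining indices keep their places.\<close>

lemma dxs_Cons_Cons:
  "dxs (m # J) (i # I) = (if i = m then dxs J I else 0)
     - (\<Sum>b<length J. if i = J ! b then dxs (J[b := m]) I else 0)"
proof -
  let ?n = "length J" and ?S = "Suc ` {..<length J}"
  have n: "{..<length (m # J)} = insert 0 ?S" by (auto simp: lessThan_Suc_eq_insert_0)
  define F where "F \<sigma> = (if i # I = permute_list \<sigma> (m # J) then of_int (sign \<sigma>) else 0 :: real)" for \<sigma>
  define G where "G b = (\<Sum>q | q permutes ?S. F (Transposition.transpose 0 b \<circ> q))" for b
  have S: "bij_betw Suc {..<?n} ?S" by (simp add: bij_betw_def)
  have mp: "map_permutation {..<?n} Suc q permutes {..<length (m # J)}"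
    "sign (map_permutation {..<?n} Suc q) = sign q" if "q permutes {..<?n}" for q
    using permutes_subset[OF map_permutation_permutes[OF S that], of "{..<length (m # J)}"] n
      sign_map_permutation[of Suc, OF _ that] by (auto simp: inj_on_def)
  have "dxs (m # J) (i # I) = (\<Sum>\<sigma> | \<sigma> permutes insert 0 ?S. F \<sigma>)"
    unfolding dxs_def F_def n ..
  \<comment> \<open>Every permutation factors uniquely into one that fixes 0 and a transposition of
    0 with some \<open>b\<close>. The transposition puts \<open>m\<close> in the place of an entry
    of \<open>J\<close>, which explains both the replacement and the minus sign.\<close>
  also have "\<dots> = (\<Sum>b\<in>insert 0 ?S. G b)"
    unfolding G_def by (rule sum_over_permutations_insert) auto
  also have "\<dots> = G 0 + (\<Sum>b<?n. G (Suc b))"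
    by (subst sum.insert) (auto simp: sum.reindex)
  also have "G 0 = (if i = m then dxs J I else 0)"
    unfolding G_def sum_permutations_map[OF S] F_def dxs_def
    by (auto simp: map_permutation_Suc_permute_list mp(2) intro!: sum.neutral sum.cong)
  also have "(\<Sum>b<?n. G (Suc b)) = (\<Sum>b<?n. - (if i = J ! b then dxs (J[b := m]) I else 0))"
  proof (rule sum.cong)
    fix b assume b: "b \<in> {..<?n}"
    have tl: "permute_list (Transposition.transpose 0 (Suc b)) (m # J) = J ! b # J[b := m]"
      using b by (intro permute_list_transpose_Cons) simp
    have F: "F (Transposition.transpose 0 (Suc b) \<circ> map_permutation {..<?n} Suc q)
        = - (if i = J ! b then if I = permute_list q (J[b := m]) then of_int (sign q) else 0 else 0)"
      if q: "q permutes {..<?n}" for q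
    proof -
      have "sign (Transposition.transpose 0 (Suc b) \<circ> map_permutation {..<?n} Suc q) = - sign q"
        using mp[OF q] by (subst sign_compose)
          (auto simp: sign_swap_id permutation_swap_id intro: permutes_imp_permutation[of "{..<length (m # J)}"])
      moreover have "permute_list (Transposition.transpose 0 (Suc b) \<circ> map_permutation {..<?n} Suc q) (m # J)
          = J ! b # permute_list q (J[b := m])"
        using map_permutation_Suc_permute_list[of q "J[b := m]"] q mp(1)[OF q] tl
        by (subst permute_list_compose) auto
      ultimately show ?thesis by (simp add: F_def)
    qed
    show "G (Suc b) = - (if i = J ! b then dxs (J[b := m]) I else 0)"
      unfolding G_def sum_permutations_map[OF S] dxs_def
      by (auto simp: F sum_negf intro!: sum.neutral sum.cong)
  qed simp
  finally show ?thesis by (simp add: sum_negf)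
qed

section \<open>Pullbacks\<close>

lemma sum_lists_Suc:
  "(\<Sum>J :: 'n::finite list | length J = Suc n. f J) = (\<Sum>i\<in>UNIV. \<Sum>J | length J = n. f (i # J))"
proof -
  have "{J :: 'n list. length J = Suc n} = (\<lambda>(i, J). i # J) ` (UNIV \<times> {J. length J = n})"
    by (auto simp: length_Suc_conv image_iff)
  moreover have "inj_on (\<lambda>(i, J). i # J) (UNIV \<times> {J :: 'n list. length J = n})"
    by (auto simp: inj_on_def)
  ultimately show ?thesis by (simp add: sum.reindex sum.cartesian_product case_prod_unfold)
qed

lemma finite_lists_length: "finite {J :: 'n::finite list. length J = n}"
  using finite_lists_length_eq[of "UNIV :: 'n set" n] by simp

lemma pullback_Nil [simp]: "pullback A \<alpha> [] = \<alpha> []"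
  by (simp add: pullback_def)

text \<open>Splitting off the first index turns facts about pullbacks into inductions on the index
  list in which the tensor stays arbitrary.\<close>

lemma pullback_Cons:
  "pullback A \<alpha> (i # I) = (\<Sum>j\<in>UNIV. A $ j $ i * pullback A (\<lambda>J. \<alpha> (j # J)) I)"
  unfolding pullback_def list.size(4) add_Suc_right add_0_right sum_lists_Suc
  by (simp add: prod.lessThan_Suc_shift sum_distrib_left mult.assoc del: prod.lessThan_Suc)

lemma pullback_cong:
  "(\<And>J. length J = length I \<Longrightarrow> \<alpha> J = \<beta> J) \<Longrightarrow> pullback A \<alpha> I = pullback A \<beta> I"
  unfolding pullback_def by (intro sum.cong) auto

lemma pullback_sum: "pullback A (\<lambda>I. \<Sum>x\<in>S. \<alpha> x I) I = (\<Sum>x\<in>S. pullback A (\<alpha> x) I)"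
  unfolding pullback_def sum_distrib_left by (rule sum.swap)

lemma pullback_scale: "pullback A (\<lambda>I. c * \<alpha> I) I = c * pullback A \<alpha> I"
  unfolding pullback_def sum_distrib_left by (simp add: mult.left_commute)

lemma pullback_add: "pullback A (\<lambda>I. \<alpha> I + \<beta> I) I = pullback A \<alpha> I + pullback A \<beta> I"
  unfolding pullback_def by (simp add: distrib_left sum.distrib)

lemma pullback_divide: "pullback A (\<lambda>I. \<alpha> I / c) I = pullback A \<alpha> I / c"
  using pullback_scale[of A "1/c" \<alpha> I] by simp

lemma pullback_mat_1 [simp]: "pullback (mat 1) \<alpha> I = \<alpha> I"
proof (induction I arbitrary: \<alpha>)
  case (Cons i I)
  have "pullback (mat 1) \<alpha> (i # I) = (\<Sum>j\<in>UNIV. if j = i then \<alpha> (j # I) else 0)"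
    unfolding pullback_Cons Cons.IH by (intro sum.cong) (auto simp: mat_def)
  then show ?case by simp
qed simp

lemma pullback_pullback: "pullback A (pullback B \<alpha>) I = pullback (B ** A) \<alpha> I"
proof (induction I arbitrary: \<alpha>)
  case (Cons i I)
  have "pullback A (pullback B \<alpha>) (i # I)
      = (\<Sum>j\<in>UNIV. \<Sum>k\<in>UNIV. B $ k $ j * A $ j $ i * pullback (B ** A) (\<lambda>J. \<alpha> (k # J)) I)"
    unfolding pullback_Cons pullback_sum pullback_scale Cons.IH
    by (simp add: sum_distrib_left mult_ac)
  also have "\<dots> = pullback (B ** A) \<alpha> (i # I)"
    unfolding pullback_Cons by (subst sum.swap) (simp add: matrix_matrix_mult_def sum_distrib_right)
  finally show ?case .
qed simp

lemma interior_product_pullback: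
  "interior_product u (pullback A \<alpha>) I = pullback A (interior_product (A *v u) \<alpha>) I"
proof -
  have "interior_product u (pullback A \<alpha>) I
      = (\<Sum>i\<in>UNIV. \<Sum>j\<in>UNIV. A $ j $ i * u $ i * pullback A (\<lambda>J. \<alpha> (j # J)) I)"
    unfolding interior_product_def pullback_Cons sum_distrib_left by (simp add: mult_ac)
  also have "\<dots> = pullback A (interior_product (A *v u) \<alpha>) I"
    unfolding interior_product_def pullback_sum pullback_scale
    by (subst sum.swap) (simp add: matrix_vector_mult_def sum_distrib_right)
  finally show ?thesis .
qed

text \<open>The function under the pullback is a tensor product, split at position \<open>k\<close>;
  together with permutations of the indices this yields naturality of the wedge product.\<close>

lemma pullback_take_drop:
  "pullback A (\<lambda>I. \<alpha> (take k I) * \<beta> (drop k I)) I = pullback A \<alpha> (take k I) * pullback A \<beta> (drop k I)"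
proof (induction I arbitrary: k \<alpha>)
  case (Cons i I)
  show ?case
  proof (cases k)
    case 0
    then show ?thesis by (simp add: pullback_scale)
  next
    case (Suc l)
    then show ?thesis
      using Cons.IH[of "\<lambda>J. \<alpha> (_ # J)" l] by (simp add: pullback_Cons sum_distrib_right mult.assoc)
  qed
qed simp

lemma pullback_permute_list:
  assumes "\<sigma> permutes {..<length I}"
  shows "pullback A (\<lambda>J. \<alpha> (permute_list \<sigma> J)) I = pullback A \<alpha> (permute_list \<sigma> I)"
proof -
  let ?S = "{J :: 'a list. length J = length I}"
  have inv: "inv \<sigma> permutes {..<length I}" by (rule permutes_inv[OF assms])
  have 1: "permute_list \<sigma> (permute_list (inv \<sigma>) J) = J" if "J \<in> ?S" for J
    using permute_list_compose[of \<sigma> J "inv \<sigma>"] that assms permutes_inv_o(2)[OF assms] by simp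
  have 2: "permute_list (inv \<sigma>) (permute_list \<sigma> J) = J" if "J \<in> ?S" for J
    using permute_list_compose[of "inv \<sigma>" J \<sigma>] that inv permutes_inv_o(1)[OF assms] by simp
  have p: "(\<Prod>m<length I. A $ (permute_list \<sigma> J ! m) $ (permute_list \<sigma> I ! m))
      = (\<Prod>m<length I. A $ (J ! m) $ (I ! m))" if "J \<in> ?S" for J
    using that assms prod.permute[OF assms, of "\<lambda>m. A $ (J ! m) $ (I ! m)"]
    by (simp add: permute_list_nth)
  show ?thesis
    unfolding pullback_def
    by (rule sum.reindex_bij_witness[of _ "permute_list (inv \<sigma>)" "permute_list \<sigma>"])
       (simp_all add: 1 2 p)
qed

lemma pullback_wedge: "wedge (pullback A \<alpha>) (pullback A \<beta>) I = pullback A (wedge \<alpha> \<beta>) I"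
proof -
  let ?n = "length I"
  have *: "pullback A (\<lambda>J. \<alpha> (take k (permute_list \<sigma> J)) * \<beta> (drop k (permute_list \<sigma> J))) I
      = pullback A \<alpha> (take k (permute_list \<sigma> I)) * pullback A \<beta> (drop k (permute_list \<sigma> I))"
    if "\<sigma> permutes {..<?n}" for k \<sigma>
    using pullback_permute_list[OF that, of A "\<lambda>I. \<alpha> (take k I) * \<beta> (drop k I)"] pullback_take_drop
    by metis
  have "pullback A (wedge \<alpha> \<beta>) I = pullback A (\<lambda>J. \<Sum>k\<le>?n. (\<Sum>\<sigma> | \<sigma> permutes {..<?n}.
       of_int (sign \<sigma>) * (\<alpha> (take k (permute_list \<sigma> J)) * \<beta> (drop k (permute_list \<sigma> J))))
     / (fact k * fact (?n - k))) I"
    by (rule pullback_cong) (simp add: wedge_def mult.assoc)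
  also have "\<dots> = wedge (pullback A \<alpha>) (pullback A \<beta>) I"
    unfolding pullback_sum pullback_divide pullback_scale wedge_def
    by (intro sum.cong refl arg_cong2[of _ _ _ _ "(/)"]) (simp add: * mult.assoc)
  finally show ?thesis ..
qed

text \<open>\<open>C\<close> is the inverse transpose of \<open>A\<close>, so indices transforming
  with \<open>C\<close> cancel those transforming with \<open>A\<close>, one contracted pair per
  induction step. This invariance of contractions is the core of the naturality of the Hodge
  star.\<close>

lemma sum_pullback_contract:
  assumes "A ** transpose C = mat 1"
  shows "(\<Sum>I | length I = n. pullback C \<alpha> I * pullback A \<omega> (I @ J))
    = pullback A (\<lambda>J. \<Sum>I | length I = n. \<alpha> I * \<omega> (I @ J)) J"
proof (induction n arbitrary: \<alpha> \<omega>)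
  case 0
  then show ?case by (simp add: pullback_scale)
next
  case (Suc n)
  have CA: "(\<Sum>i\<in>UNIV. C $ p $ i * A $ q $ i) = (if q = p then 1 else 0)" for p q
    using arg_cong[OF assms, of "\<lambda>M. M $ q $ p"]
    by (simp add: matrix_matrix_mult_def transpose_def mat_def mult.commute)
  define P where "P p I = pullback C (\<lambda>J. \<alpha> (p # J)) I" for p I
  define Q where "Q q I = pullback A (\<lambda>J. \<omega> (q # J)) (I @ J)" for q I
  have "(\<Sum>I | length I = Suc n. pullback C \<alpha> I * pullback A \<omega> (I @ J))
      = (\<Sum>i\<in>UNIV. \<Sum>I | length I = n. \<Sum>p\<in>UNIV. \<Sum>q\<in>UNIV. C $ p $ i * A $ q $ i * (P p I * Q q I))"
    unfolding sum_lists_Suc append_Cons pullback_Cons P_def[symmetric] Q_def[symmetric]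
      sum_product by (simp add: mult_ac)
  also have "\<dots> = (\<Sum>i\<in>UNIV. \<Sum>p\<in>UNIV. \<Sum>q\<in>UNIV. C $ p $ i * A $ q $ i * (\<Sum>I | length I = n. P p I * Q q I))"
    unfolding sum_distrib_left by (intro sum.cong refl, subst sum.swap, intro sum.cong refl, rule sum.swap)
  also have "\<dots> = (\<Sum>p\<in>UNIV. \<Sum>q\<in>UNIV. (\<Sum>i\<in>UNIV. C $ p $ i * A $ q $ i) * (\<Sum>I | length I = n. P p I * Q q I))"
    unfolding sum_distrib_right by (subst sum.swap, rule sum.cong[OF refl], rule sum.swap)
  also have "\<dots> = (\<Sum>p\<in>UNIV. \<Sum>q\<in>UNIV. if q = p then \<Sum>I | length I = n. P p I * Q q I else 0)"
    unfolding CA by (intro sum.cong) auto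
  also have "\<dots> = (\<Sum>p\<in>UNIV. \<Sum>I | length I = n. P p I * Q p I)"
    by simp
  also have "\<dots> = pullback A (\<lambda>J. \<Sum>I | length I = Suc n. \<alpha> I * \<omega> (I @ J)) J"
    unfolding P_def Q_def Suc.IH sum_lists_Suc append_Cons pullback_sum ..
  finally show ?case .
qed

lemma raise_all_pullback: "raise_all g \<alpha> = pullback (transpose (matrix_inv g)) \<alpha>"
  unfolding raise_all_def pullback_def transpose_def by simp

section \<open>The derivation action of matrices\<close>

text \<open>The derivative at the identity of the pullback in the direction \<^term>\<open>H\<close>.\<close>

definition act :: "real^'n^'n \<Rightarrow> 'n::finite tensor \<Rightarrow> 'n tensor" where
  "act H \<alpha> I = (\<Sum>m<length I. \<Sum>l\<in>UNIV. H $ l $ (I ! m) * \<alpha> (I[m := l]))"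

lemma act_Nil [simp]: "act H \<alpha> [] = 0"
  by (simp add: act_def)

lemma act_Cons:
  "act H \<alpha> (i # I) = (\<Sum>l\<in>UNIV. H $ l $ i * \<alpha> (l # I)) + act H (\<lambda>J. \<alpha> (i # J)) I"
  by (simp add: act_def sum.lessThan_Suc_shift del: sum.lessThan_Suc)

lemma act_sum: "act H (\<lambda>I. \<Sum>x\<in>S. c x * \<alpha> x I) I = (\<Sum>x\<in>S. c x * act H (\<alpha> x) I)"
proof (induction I arbitrary: \<alpha>)
  case (Cons i I)
  have "(\<Sum>l\<in>UNIV. H $ l $ i * (\<Sum>x\<in>S. c x * \<alpha> x (l # I)))
      = (\<Sum>x\<in>S. c x * (\<Sum>l\<in>UNIV. H $ l $ i * \<alpha> x (l # I)))"
    unfolding sum_distrib_left by (subst sum.swap) (simp add: mult_ac)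
  then show ?case by (simp add: act_Cons Cons.IH distrib_left sum.distrib)
qed simp

text \<open>To first order \<open>A + e K\<close> equals \<open>(1 + e H) A (1 + e M)\<close>. As
  pullbacks reverse the order of composition, \<open>H\<close> acts before the pullback by
  \<open>A\<close> and \<open>M\<close> after it.\<close>

lemma has_derivative_pullback:
  fixes A :: "real^'n^'n::finite"
  assumes K: "K = A ** M + H ** A"
  shows "((\<lambda>s. pullback (A + (s - t) *\<^sub>R K) \<alpha> I) has_real_derivative
    act M (pullback A \<alpha>) I + pullback A (act H \<alpha>) I) (at t)"
proof (induction I arbitrary: \<alpha>)
  case (Cons i I)
  let ?P = "\<lambda>j s. pullback (A + (s - t) *\<^sub>R K) (\<lambda>J. \<alpha> (j # J)) I"
  let ?D = "\<lambda>j. act M (pullback A (\<lambda>J. \<alpha> (j # J))) I + pullback A (act H (\<lambda>J. \<alpha> (j # J))) I"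
  have "((\<lambda>s. \<Sum>j\<in>UNIV. (A $ j $ i + (s - t) * K $ j $ i) * ?P j s) has_real_derivative
      (\<Sum>j\<in>UNIV. K $ j $ i * ?P j t + (A $ j $ i + (t - t) * K $ j $ i) * ?D j)) (at t)"
    by (intro DERIV_sum) (auto intro!: derivative_eq_intros Cons.IH)
  moreover have "(\<Sum>j\<in>UNIV. K $ j $ i * ?P j t + (A $ j $ i + (t - t) * K $ j $ i) * ?D j)
      = act M (pullback A \<alpha>) (i # I) + pullback A (act H \<alpha>) (i # I)"
  proof -
    have 1: "act M (pullback A \<alpha>) (i # I)
        = (\<Sum>j\<in>UNIV. (A ** M) $ j $ i * pullback A (\<lambda>J. \<alpha> (j # J)) I)
          + (\<Sum>j\<in>UNIV. A $ j $ i * act M (pullback A (\<lambda>J. \<alpha> (j # J))) I)"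
      unfolding act_Cons pullback_Cons act_sum sum_distrib_left matrix_matrix_mult_def
      by (subst sum.swap) (simp add: sum_distrib_left sum_distrib_right mult_ac)
    have 2: "pullback A (act H \<alpha>) (i # I)
        = (\<Sum>j\<in>UNIV. (H ** A) $ j $ i * pullback A (\<lambda>J. \<alpha> (j # J)) I)
          + (\<Sum>j\<in>UNIV. A $ j $ i * pullback A (act H (\<lambda>J. \<alpha> (j # J))) I)"
      unfolding act_Cons pullback_Cons pullback_add pullback_sum pullback_scale distrib_left
        sum.distrib sum_distrib_left matrix_matrix_mult_def
      by (subst sum.swap) (simp add: sum_distrib_left sum_distrib_right mult_ac)
    show ?thesis
      unfolding 1 2 by (simp add: K algebra_simps sum.distrib)
  qed
  ultimately show ?case
    by (simp add: pullback_Cons)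
qed simp

text \<open>A column operation on the determinant in the definition of \<^term>\<open>dxs J I\<close> summed over all
  columns is the same row operation summed over all rows.\<close>

lemma act_dxs:
  "act H (dxs J) I = (\<Sum>m<length J. \<Sum>a\<in>UNIV. H $ (J ! m) $ a * dxs (J[m := a]) I)"
proof (cases "length I = length J")
  case True
  \<comment> \<open>The contribution of one permutation \<sigma> with the delta in position
    \<open>m\<close> replaced by an entry of \<open>H\<close>. Both sides are the double sum of
    these; on the right, position \<open>m\<close> of \<open>I\<close> belongs to position
    \<open>\<sigma> m\<close> of \<open>J\<close>.\<close>
  define R where "R m \<sigma> = (of_int (sign \<sigma>) * H $ (J ! \<sigma> m) $ (I ! m)
    * (if \<forall>q<length J. q \<noteq> m \<longrightarrow> I ! q = J ! \<sigma> q then 1 else 0) :: real)" for m \<sigma>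
  have eq: "K = L \<longleftrightarrow> (\<forall>q<length K. K ! q = L ! q)" if "length K = length L" for K L :: "'a list"
    using that by (auto simp: list_eq_iff_nth_eq)
  have 1: "(\<Sum>l\<in>UNIV. H $ l $ (I ! m) * dxs J (I[m := l])) = (\<Sum>\<sigma> | \<sigma> permutes {..<length J}. R m \<sigma>)"
    if m: "m < length J" for m
  proof -
    have "(\<Sum>l\<in>UNIV. H $ l $ (I ! m) * (if I[m := l] = permute_list \<sigma> J then of_int (sign \<sigma>) else 0)) = R m \<sigma>"
      if \<sigma>: "\<sigma> permutes {..<length J}" for \<sigma>
    proof -
      have "I[m := l] = permute_list \<sigma> J \<longleftrightarrow> l = J ! \<sigma> m \<and> (\<forall>q<length J. q \<noteq> m \<longrightarrow> I ! q = J ! \<sigma> q)" for l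
        using True \<sigma> m by (subst eq) (auto simp: permute_list_nth nth_list_update)
      then have "(\<Sum>l\<in>UNIV. H $ l $ (I ! m) * (if I[m := l] = permute_list \<sigma> J then of_int (sign \<sigma>) else 0))
          = (\<Sum>l\<in>UNIV. if l = J ! \<sigma> m then R m \<sigma> else 0)"
        by (intro sum.cong) (auto simp: R_def)
      then show ?thesis by simp
    qed
    then show ?thesis
      unfolding dxs_def sum_distrib_left by (subst sum.swap) (intro sum.cong, auto)
  qed
  have 2: "(\<Sum>m<length J. \<Sum>a\<in>UNIV. H $ (J ! m) $ a * (if I = permute_list \<sigma> (J[m := a]) then of_int (sign \<sigma>) else 0))
      = (\<Sum>m<length J. R m \<sigma>)" if \<sigma>: "\<sigma> permutes {..<length J}" for \<sigma>
  proof -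
    have in1: "\<sigma> m < length J \<longleftrightarrow> m < length J" for m using permutes_in_image[OF \<sigma>, of m] by simp
    have "(\<Sum>a\<in>UNIV. H $ (J ! \<sigma> m) $ a * (if I = permute_list \<sigma> (J[\<sigma> m := a]) then of_int (sign \<sigma>) else 0))
      = R m \<sigma>" if m: "m < length J" for m
    proof -
      have "I = permute_list \<sigma> (J[\<sigma> m := a]) \<longleftrightarrow> a = I ! m \<and> (\<forall>q<length J. q \<noteq> m \<longrightarrow> I ! q = J ! \<sigma> q)" for a
        using True \<sigma> m in1 permutes_inj[OF \<sigma>]
        by (subst eq) (auto simp: permute_list_nth nth_list_update inj_eq)
      then have "(\<Sum>a\<in>UNIV. H $ (J ! \<sigma> m) $ a * (if I = permute_list \<sigma> (J[\<sigma> m := a]) then of_int (sign \<sigma>) else 0))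
          = (\<Sum>a\<in>UNIV. if a = I ! m then R m \<sigma> else 0)"
        by (intro sum.cong) (auto simp: R_def)
      then show ?thesis by simp
    qed
    then show ?thesis
      by (subst sum.permute[OF \<sigma>]) (simp add: o_def)
  qed
  have "act H (dxs J) I = (\<Sum>\<sigma> | \<sigma> permutes {..<length J}. \<Sum>m<length J. R m \<sigma>)"
    unfolding act_def True by (subst sum.swap) (simp add: 1)
  also have "\<dots> = (\<Sum>\<sigma> | \<sigma> permutes {..<length J}. \<Sum>m<length J. \<Sum>a\<in>UNIV.
      H $ (J ! m) $ a * (if I = permute_list \<sigma> (J[m := a]) then of_int (sign \<sigma>) else 0))"
    by (rule sum.cong[OF refl]) (simp only: mem_Collect_eq 2)
  also have "\<dots> = (\<Sum>m<length J. \<Sum>a\<in>UNIV. H $ (J ! m) $ a * dxs (J[m := a]) I)"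
    unfolding dxs_def sum_distrib_left length_list_update
    by (subst sum.swap, intro sum.cong refl, rule sum.swap)
  finally show ?thesis .
qed (simp add: act_def dxs_length)

section \<open>Wedge products of elementary forms\<close>

lemma dxs_append_permute_left:
  assumes "\<tau> permutes {..<length I}"
  shows "dxs (permute_list \<tau> I @ J) K = of_int (sign \<tau>) * dxs (I @ J) K"
proof -
  have \<tau>: "\<tau> permutes {..<length (I @ J)}"
    by (rule permutes_subset[OF assms]) auto
  have "permute_list \<tau> (I @ J) = permute_list \<tau> I @ J"
  proof (rule nth_equalityI)
    fix i assume "i < length (permute_list \<tau> (I @ J))"
    then have i: "i < length (I @ J)" by simp
    show "permute_list \<tau> (I @ J) ! i = (permute_list \<tau> I @ J) ! i"
      unfolding permute_list_nth[OF \<tau> i]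
      using permutes_in_image[OF assms, of i] permutes_not_in[OF assms, of i]
      by (cases "i < length I") (simp_all add: nth_append permute_list_nth[OF assms])
  qed simp
  then show ?thesis using dxs_permute_left[OF \<tau>, of K] by simp
qed

text \<open>The permutation of the second block is conjugated by the shift past \<open>I\<close> and
  extended by the identity, which preserves its sign.\<close>

lemma dxs_append_permute_right:
  assumes "\<rho> permutes {..<length J}"
  shows "dxs (I @ permute_list \<rho> J) K = of_int (sign \<rho>) * dxs (I @ J) K"
proof -
  let ?f = "\<lambda>i. length I + i"
  define \<tau> where "\<tau> = map_permutation {..<length J} ?f \<rho>"
  have inj: "inj_on ?f {..<length J}" by (simp add: inj_on_def)
  have \<tau>': "\<tau> permutes ?f ` {..<length J}"
    unfolding \<tau>_def by (rule map_permutation_permutes[OF _ assms]) (simp add: bij_betw_def inj)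
  have \<tau>: "\<tau> permutes {..<length (I @ J)}"
    by (rule permutes_subset[OF \<tau>']) auto
  have s: "sign \<tau> = sign \<rho>"
    unfolding \<tau>_def by (rule sign_map_permutation[OF inj assms]) simp
  have "permute_list \<tau> (I @ J) = I @ permute_list \<rho> J"
  proof (rule nth_equalityI)
    fix i assume "i < length (permute_list \<tau> (I @ J))"
    then have i: "i < length (I @ J)" by simp
    show "permute_list \<tau> (I @ J) ! i = (I @ permute_list \<rho> J) ! i"
    proof (cases "i < length I")
      case True
      then have "\<tau> i = i" by (intro permutes_not_in[OF \<tau>']) auto
      then show ?thesis using True by (simp only: permute_list_nth[OF \<tau> i]) (simp add: nth_append)
    next
      case False
      then obtain j where j: "i = length I + j" "j < length J"
        using i by (metis add_diff_inverse_nat length_append nat_add_left_cancel_less)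
      then have "\<tau> i = length I + \<rho> j"
        unfolding \<tau>_def j by (intro map_permutation_apply[OF inj]) simp
      then show ?thesis
        by (simp only: permute_list_nth[OF \<tau> i]) (simp add: nth_append j permute_list_nth[OF assms])
    qed
  qed simp
  then show ?thesis using dxs_permute_left[OF \<tau>, of K] s by simp
qed

text \<open>Only the splitting at \<open>length I\<close> has matching degrees. There each pair of
  permutations of the two blocks contributes \<open>dxs (I @ J) K\<close> with total sign 1, and the
  number of pairs cancels the factorials in \<open>wedge\<close>.\<close>

lemma wedge_dxs: "wedge (dxs I) (dxs J) K = dxs (I @ J) K"
proof (cases "length K = length I + length J")
  case False
  have "dxs I (take k (permute_list \<sigma> K)) * dxs J (drop k (permute_list \<sigma> K)) = 0"
    if "k \<le> length K" for k \<sigma>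
    using False that by (cases "k = length I") (auto simp: dxs_length)
  then have "wedge (dxs I) (dxs J) K = 0"
    unfolding wedge_def mult.assoc by (simp add: sum.neutral)
  then show ?thesis using False by (simp add: dxs_length)
next
  case True
  let ?m = "length I" and ?n = "length K"
  define T where "T k = (\<Sum>\<sigma> | \<sigma> permutes {..<?n}. of_int (sign \<sigma>) * dxs I (take k (permute_list \<sigma> K))
    * dxs J (drop k (permute_list \<sigma> K)))" for k
  have T0: "T k = 0" if "k \<noteq> ?m" "k \<le> ?n" for k
    unfolding T_def using that by (intro sum.neutral) (simp add: dxs_length)
  let ?P = "{\<tau>. \<tau> permutes {..<?m}}" and ?R = "{\<rho>. \<rho> permutes {..<length J}}"
  have prod: "dxs I (take ?m L) * dxs J (drop ?m L) = (\<Sum>\<tau>\<in>?P. \<Sum>\<rho>\<in>?R. of_int (sign \<tau>) * of_int (sign \<rho>)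
      * (if L = permute_list \<tau> I @ permute_list \<rho> J then 1 else 0))" if "length L = ?n" for L
  proof -
    have "L = permute_list \<tau> I @ permute_list \<rho> J
      \<longleftrightarrow> take ?m L = permute_list \<tau> I \<and> drop ?m L = permute_list \<rho> J" for \<tau> \<rho>
      using append_eq_conv_conj[of "permute_list \<tau> I" "permute_list \<rho> J" L] by auto
    then show ?thesis
      unfolding dxs_def sum_product by (intro sum.cong refl) auto
  qed
  have "T ?m = (\<Sum>\<sigma> | \<sigma> permutes {..<?n}. \<Sum>\<tau>\<in>?P. \<Sum>\<rho>\<in>?R. of_int (sign \<tau>) * of_int (sign \<rho>)
      * (if permute_list \<tau> I @ permute_list \<rho> J = permute_list \<sigma> K then of_int (sign \<sigma>) else 0))"
    unfolding T_def mult.assoc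
    by (rule sum.cong[OF refl], subst prod)
       (auto simp: sum_distrib_left mult_ac intro!: sum.cong)
  also have "\<dots> = (\<Sum>\<tau>\<in>?P. \<Sum>\<rho>\<in>?R. of_int (sign \<tau>) * of_int (sign \<rho>)
      * dxs K (permute_list \<tau> I @ permute_list \<rho> J))"
    unfolding dxs_def[of K] sum_distrib_left
    by (subst sum.swap, rule sum.cong[OF refl], rule sum.swap)
  also have "\<dots> = (\<Sum>\<tau>\<in>?P. \<Sum>\<rho>\<in>?R. dxs (I @ J) K)"
    unfolding dxs_sym[of K]
    by (intro sum.cong refl)
       (simp add: dxs_append_permute_left dxs_append_permute_right sign_mult_self_left mult_ac)
  also have "\<dots> = fact ?m * fact (length J) * dxs (I @ J) K"
    by (simp add: card_permutations)
  finally have Tm: "T ?m = fact ?m * fact (length J) * dxs (I @ J) K" .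
  have "wedge (dxs I) (dxs J) K = (\<Sum>k\<le>?n. T k / (fact k * fact (?n - k)))"
    unfolding wedge_def T_def ..
  also have "\<dots> = (\<Sum>k\<le>?n. if k = ?m then dxs (I @ J) K else 0)"
    using T0 Tm True by (intro sum.cong) auto
  finally show ?thesis using True by simp
qed

lemma wedge_sum_left: "wedge (\<lambda>I. \<Sum>x\<in>S. c x * \<alpha> x I) \<beta> K = (\<Sum>x\<in>S. c x * wedge (\<alpha> x) \<beta> K)"
proof -
  define A where "A k \<sigma> x = of_int (sign \<sigma>) * \<alpha> x (take k (permute_list \<sigma> K)) * \<beta> (drop k (permute_list \<sigma> K))" for k \<sigma> x
  have "(\<Sum>x\<in>S. c x * wedge (\<alpha> x) \<beta> K)
      = (\<Sum>x\<in>S. \<Sum>k\<le>length K. \<Sum>\<sigma> | \<sigma> permutes {..<length K}. c x * A k \<sigma> x / (fact k * fact (length K - k)))"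
    unfolding wedge_def sum_divide_distrib sum_distrib_left A_def by simp
  also have "\<dots> = (\<Sum>k\<le>length K. \<Sum>\<sigma> | \<sigma> permutes {..<length K}. \<Sum>x\<in>S. c x * A k \<sigma> x / (fact k * fact (length K - k)))"
    by (subst sum.swap, rule sum.cong[OF refl], rule sum.swap)
  also have "\<dots> = wedge (\<lambda>I. \<Sum>x\<in>S. c x * \<alpha> x I) \<beta> K"
    unfolding wedge_def sum_divide_distrib A_def sum_distrib_left sum_distrib_right by (simp add: mult_ac)
  finally show ?thesis ..
qed

lemma wedge_sum_right: "wedge \<beta> (\<lambda>I. \<Sum>x\<in>S. c x * \<alpha> x I) K = (\<Sum>x\<in>S. c x * wedge \<beta> (\<alpha> x) K)"
proof -
  define A where "A k \<sigma> x = of_int (sign \<sigma>) * \<beta> (take k (permute_list \<sigma> K)) * \<alpha> x (drop k (permute_list \<sigma> K))" for k \<sigma> x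
  have "(\<Sum>x\<in>S. c x * wedge \<beta> (\<alpha> x) K)
      = (\<Sum>x\<in>S. \<Sum>k\<le>length K. \<Sum>\<sigma> | \<sigma> permutes {..<length K}. c x * A k \<sigma> x / (fact k * fact (length K - k)))"
    unfolding wedge_def sum_divide_distrib sum_distrib_left A_def by simp
  also have "\<dots> = (\<Sum>k\<le>length K. \<Sum>\<sigma> | \<sigma> permutes {..<length K}. \<Sum>x\<in>S. c x * A k \<sigma> x / (fact k * fact (length K - k)))"
    by (subst sum.swap, rule sum.cong[OF refl], rule sum.swap)
  also have "\<dots> = wedge \<beta> (\<lambda>I. \<Sum>x\<in>S. c x * \<alpha> x I) K"
    unfolding wedge_def sum_divide_distrib A_def sum_distrib_left sum_distrib_right by (simp add: mult_ac)
  finally show ?thesis ..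
qed

section \<open>Computing with integer combinations of elementary forms\<close>

text \<open>The labels are integers, so that identities between forms can be decided by evaluation;
  \<open>of_int\<close> carries them to the index type, where it identifies labels modulo 7. This is
  why \<open>in_range\<close> restricts them to 1 to 7.\<close>

definition val :: "(int \<times> int list) list \<Rightarrow> 7 tensor" where
  "val P I = (\<Sum>(c, l)\<leftarrow>P. of_int c * dxs (map of_int l) I)"

definition in_range :: "(int \<times> int list) list \<Rightarrow> bool" where
  "in_range P \<longleftrightarrow> (\<forall>(c, l)\<in>set P. set l \<subseteq> {1..7})"

definition smult_terms :: "int \<Rightarrow> (int \<times> int list) list \<Rightarrow> (int \<times> int list) list" where
  "smult_terms d P = map (\<lambda>(c, l). (d * c, l)) P"

definition mult_terms :: "(int \<times> int list) list \<Rightarrow> (int \<times> int list) list \<Rightarrow> (int \<times> int list) list" where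
  "mult_terms P Q = concat (map (\<lambda>(c, l). map (\<lambda>(d, k). (c * d, l @ k)) Q) P)"

text \<open>The right side of \<open>dxs_Cons_Cons\<close> as data, for a fixed first component
  index.\<close>

fun contract_list :: "int \<Rightarrow> int list \<Rightarrow> (int \<times> int list) list" where
  "contract_list i [] = []"
| "contract_list i (m # J) = (if i = m then [(1, J)] else [])
     @ map (\<lambda>b. (-1, J[b := m])) (filter (\<lambda>b. i = J ! b) [0..<length J])"

definition contract_terms :: "int \<Rightarrow> (int \<times> int list) list \<Rightarrow> (int \<times> int list) list" where
  "contract_terms i P = concat (map (\<lambda>(c, l). smult_terms c (contract_list i l)) P)"

text \<open>The right side of \<open>act_dxs\<close> as data: each index is replaced in turn,
  weighted by a row of the matrix.\<close>

fun act_list :: "(int \<Rightarrow> int \<Rightarrow> int) \<Rightarrow> int list \<Rightarrow> (int \<times> int list) list" where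
  "act_list h [] = []"
| "act_list h (j # J) = map (\<lambda>a. (h j a, a # J)) [1..7] @ map (\<lambda>(c, l). (c, j # l)) (act_list h J)"

definition act_terms :: "(int \<Rightarrow> int \<Rightarrow> int) \<Rightarrow> (int \<times> int list) list \<Rightarrow> (int \<times> int list) list" where
  "act_terms h P = concat (map (\<lambda>(c, l). smult_terms c (act_list h l)) P)"

text \<open>A repeated index is reported by the sign 0, and the list returned with it carries no
  information.\<close>

fun insert_sign :: "int \<Rightarrow> int list \<Rightarrow> int \<times> int list" where
  "insert_sign x [] = (1, [x])"
| "insert_sign x (y # ys) = (if x < y then (1, x # y # ys) else if x = y then (0, [])
     else case insert_sign x ys of (s, l) \<Rightarrow> (- s, y # l))"

fun sort_sign :: "int list \<Rightarrow> int \<times> int list" where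
  "sort_sign [] = (1, [])"
| "sort_sign (x # xs) = (case sort_sign xs of (s, l) \<Rightarrow> case insert_sign x l of (t, k) \<Rightarrow> (s * t, k))"

fun add_term :: "int \<Rightarrow> int list \<Rightarrow> (int \<times> int list) list \<Rightarrow> (int \<times> int list) list" where
  "add_term c l [] = [(c, l)]"
| "add_term c l ((d, k) # P) = (if l = k then (c + d, k) # P else (d, k) # add_term c l P)"

fun collect_terms :: "(int \<times> int list) list \<Rightarrow> (int \<times> int list) list" where
  "collect_terms [] = []"
| "collect_terms ((c, l) # P) = (if c = 0 then collect_terms P else
     case sort_sign l of (s, k) \<Rightarrow> if s = 0 then collect_terms P else add_term (c * s) k (collect_terms P))"

definition vanishes :: "(int \<times> int list) list \<Rightarrow> bool" where
  "vanishes P \<longleftrightarrow> list_all (\<lambda>(c, l). c = 0) (collect_terms P)"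

section \<open>Soundness of the computations with terms\<close>

lemma val_Nil [simp]: "val [] I = 0"
  by (simp add: val_def)

lemma val_Cons [simp]: "val ((c, l) # P) I = of_int c * dxs (map of_int l) I + val P I"
  by (simp add: val_def)

lemma val_append [simp]: "val (P @ Q) I = val P I + val Q I"
  by (simp add: val_def)

lemma val_smult_terms [simp]: "val (smult_terms d P) I = of_int d * val P I"
  by (induction P) (auto simp: smult_terms_def algebra_simps)

lemma in_range_simps [simp]:
  "in_range []" "in_range ((c, l) # P) \<longleftrightarrow> set l \<subseteq> {1..7} \<and> in_range P"
  "in_range (P @ Q) \<longleftrightarrow> in_range P \<and> in_range Q"
  "in_range P \<Longrightarrow> in_range (smult_terms d P)"
  by (auto simp: in_range_def smult_terms_def)

text \<open>Moving past a neighbour costs a sign, and equal neighbours make the form equal to its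
  negative. The prefix \<open>J\<close> collects the entries already passed.\<close>

lemma dxs_insert_sign:
  "insert_sign x ys = (s, l) \<Longrightarrow> dxs (J @ map f (x # ys)) I = of_int s * dxs (J @ map f l) I"
proof (induction ys arbitrary: s l J)
  case (Cons y ys)
  obtain t k where tk: "insert_sign x ys = (t, k)" by (cases "insert_sign x ys")
  have "dxs (J @ map f (x # y # ys)) I = - dxs ((J @ [f y]) @ map f (x # ys)) I"
    using dxs_swap[of J "f x" "f y" "map f ys" I] by simp
  also have "\<dots> = - of_int t * dxs ((J @ [f y]) @ map f k) I"
    using Cons.IH[OF tk, of "J @ [f y]"] by simp
  finally have 1: "dxs (J @ map f (x # y # ys)) I = - of_int t * dxs (J @ map f (y # k)) I" by simp
  have "dxs (J @ map f (y # y # ys)) I = 0"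
    using dxs_swap[of J "f y" "f y" "map f ys" I] by simp
  then show ?case using Cons.prems 1 tk by (auto split: if_splits)
qed simp

lemma dxs_sort_sign:
  "sort_sign l = (s, k) \<Longrightarrow> dxs (map f l) I = of_int s * dxs (map f k) I"
proof -
  have "sort_sign l = (s, k) \<Longrightarrow> dxs (J @ map f l) I = of_int s * dxs (J @ map f k) I" for J
  proof (induction l arbitrary: s k J)
    case (Cons x l)
    obtain t m where tm: "sort_sign l = (t, m)" by (cases "sort_sign l")
    obtain u n where un: "insert_sign x m = (u, n)" by (cases "insert_sign x m")
    have "dxs (J @ map f (x # l)) I = of_int t * dxs (J @ map f (x # m)) I"
      using Cons.IH[OF tm, of "J @ [f x]"] by simp
    then show ?case using dxs_insert_sign[OF un, of J f I] Cons.prems tm un by auto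
  qed simp
  from this[of "[]"] show "sort_sign l = (s, k) \<Longrightarrow> ?thesis" by simp
qed

lemma val_add_term: "val (add_term c l P) I = of_int c * dxs (map of_int l) I + val P I"
  by (induction c l P rule: add_term.induct) (auto simp: algebra_simps)

lemma val_collect_terms: "val (collect_terms P) I = val P I"
proof (induction P rule: collect_terms.induct)
  case (2 c l P)
  obtain s k where sk: "sort_sign l = (s, k)" by (cases "sort_sign l")
  then show ?case
    using 2 dxs_sort_sign[OF sk, of of_int I] by (auto simp: val_add_term)
qed simp

lemma val_vanishes: "vanishes P \<Longrightarrow> val P I = 0"
proof -
  have "list_all (\<lambda>(c, l). c = 0) Q \<Longrightarrow> val Q I = 0" for Q :: "(int \<times> int list) list"
    by (induction Q) auto
  then show "vanishes P \<Longrightarrow> ?thesis"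
    unfolding vanishes_def by (metis val_collect_terms)
qed

lemma val_eqI: "vanishes (P @ smult_terms (-1) Q) \<Longrightarrow> val P I = val Q I"
  using val_vanishes[of "P @ smult_terms (-1) Q" I] by simp

lemma val_eq_sum: "val P = (\<lambda>I. \<Sum>x<length P. of_int (fst (P ! x)) * dxs (map of_int (snd (P ! x))) I)"
  unfolding val_def by (simp add: sum_list_sum_nth case_prod_unfold atLeast0LessThan)

lemma wedge_val: "wedge (val P) (val Q) K = val (mult_terms P Q) K"
proof -
  have 1: "wedge (dxs l) (val Q) K = (\<Sum>(d, k)\<leftarrow>Q. of_int d * dxs (l @ map of_int k) K)" for l
    unfolding val_eq_sum wedge_sum_right wedge_dxs
    by (simp add: sum_list_sum_nth case_prod_unfold atLeast0LessThan)
  have "wedge (val P) (val Q) K = (\<Sum>(c, l)\<leftarrow>P. of_int c * wedge (dxs (map of_int l)) (val Q) K)"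
    unfolding val_eq_sum[of P] wedge_sum_left
    by (simp add: sum_list_sum_nth case_prod_unfold atLeast0LessThan)
  also have "\<dots> = val (mult_terms P Q) K"
  proof (induction P)
    case (Cons a P)
    obtain c l where a: "a = (c, l)" by (cases a)
    have "of_int c * wedge (dxs (map of_int l)) (val Q) K = val (map (\<lambda>(d, k). (c * d, l @ k)) Q) K"
      unfolding 1 by (induction Q) (auto simp: algebra_simps)
    then show ?case using Cons by (simp add: a mult_terms_def)
  qed (simp add: mult_terms_def)
  finally show ?thesis .
qed

text \<open>The assumptions translate between integer labels and the index type: \<open>h\<close>
  lists the entries of \<open>H\<close>, and \<open>sum7\<close> is the reindexing supplied by
  \<open>sum_7\<close>.\<close>

lemma act_val:
  assumes h: "\<And>l a. l \<in> {1..7} \<Longrightarrow> a \<in> {1..7} \<Longrightarrow> H $ of_int l $ of_int a = of_int (h l a)"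
    and sum7: "\<And>f :: 7 \<Rightarrow> real. (\<Sum>i\<in>UNIV. f i) = (\<Sum>i\<in>{1..7}. f (of_int i))"
    and P: "in_range P"
  shows "act H (val P) K = val (act_terms h P) K"
proof -
  have *: "(\<Sum>(c, l)\<leftarrow>act_list h J. of_int c * f (map of_int l))
      = (\<Sum>m<length J. \<Sum>a\<in>UNIV. H $ of_int (J ! m) $ a * f ((map of_int J)[m := a]))"
    if "set J \<subseteq> {1..7}" for J and f :: "7 list \<Rightarrow> real"
    using that
  proof (induction J arbitrary: f)
    case (Cons j J)
    have "(\<Sum>(c, l)\<leftarrow>map (\<lambda>(c, l). (c, j # l)) (act_list h J). of_int c * f (map of_int l))
        = (\<Sum>(c, l)\<leftarrow>act_list h J. of_int c * f (of_int j # map of_int l))"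
      by (simp add: case_prod_unfold o_def)
    moreover have "(\<Sum>(c, l)\<leftarrow>map (\<lambda>a. (h j a, a # J)) [1..7]. of_int c * f (map of_int l))
        = (\<Sum>a\<in>UNIV. H $ of_int j $ a * f (a # map of_int J))"
    proof -
      have "(\<Sum>(c, l)\<leftarrow>map (\<lambda>a. (h j a, a # J)) [1..7]. of_int c * f (map of_int l))
          = (\<Sum>a\<in>{1..7}. of_int (h j a) * f (of_int a # map of_int J))"
        unfolding map_map o_def interv_sum_list_conv_sum_set_int set_upto by simp
      also have "\<dots> = (\<Sum>a\<in>{1..7}. H $ of_int j $ of_int a * f (of_int a # map of_int J))"
        using Cons.prems h by (intro sum.cong refl) auto
      finally show ?thesis unfolding sum7 .
    qed
    ultimately show ?case
      using Cons.IH[of "\<lambda>l. f (of_int j # l)"] Cons.prems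
      by (simp add: sum.lessThan_Suc_shift del: sum.lessThan_Suc upto_rec_numeral)
  qed simp
  have 1: "act H (dxs (map of_int J)) K = val (act_list h J) K" if "set J \<subseteq> {1..7}" for J
    using *[OF that, of "\<lambda>l. dxs l K"] unfolding act_dxs val_def by simp
  have "act H (val P) K = (\<Sum>(c, l)\<leftarrow>P. of_int c * act H (dxs (map of_int l)) K)"
    unfolding val_eq_sum[of P] act_sum
    by (simp add: sum_list_sum_nth case_prod_unfold atLeast0LessThan)
  also have "\<dots> = val (act_terms h P) K"
    using P by (induction P) (auto simp: act_terms_def 1)
  finally show ?thesis .
qed

section \<open>Integer labels for the seven indices\<close>

lemma of_int_7_eq_iff:
  assumes "i \<in> {1..7}" "j \<in> {1..7}"
  shows "(of_int i :: 7) = of_int j \<longleftrightarrow> i = j"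
proof -
  have "i = 1 \<or> i = 2 \<or> i = 3 \<or> i = 4 \<or> i = 5 \<or> i = 6 \<or> i = 7"
    "j = 1 \<or> j = 2 \<or> j = 3 \<or> j = 4 \<or> j = 5 \<or> j = 6 \<or> j = 7"
    using assms by auto
  then show ?thesis by (elim disjE) simp_all
qed

lemma bij_of_int_7: "bij_betw (of_int :: int \<Rightarrow> 7) {1..7} UNIV"
proof -
  have inj: "inj_on (of_int :: int \<Rightarrow> 7) {1..7}"
    using of_int_7_eq_iff by (simp add: inj_on_def)
  have "(of_int :: int \<Rightarrow> 7) ` {1..7} = UNIV"
    by (rule card_subset_eq) (simp_all add: card_image[OF inj])
  then show ?thesis using inj by (simp add: bij_betw_def)
qed

lemma sum_7: "(\<Sum>i\<in>UNIV. f (i :: 7)) = (\<Sum>i\<in>{1..7}. f (of_int i))"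
  using sum.reindex_bij_betw[OF bij_of_int_7, of f] by simp

text \<open>The range conditions make the integer comparisons in \<open>contract_list\<close> agree
  with equality of indices modulo 7.\<close>

lemma val_contract_list:
  assumes "set J \<subseteq> {1..7}" "i \<in> {1..7}"
  shows "val (contract_list i J) I = dxs (map of_int J) (of_int i # I)"
proof (cases J)
  case Nil
  then show ?thesis by (simp add: dxs_length)
next
  case (Cons m K)
  have *: "val (map (\<lambda>b. (-1, K[b := m])) (filter (\<lambda>b. i = K ! b) bs)) I
    = (\<Sum>b\<leftarrow>bs. - (if i = K ! b then dxs (map of_int (K[b := m])) I else 0))" for bs
    by (induction bs) auto
  have "(\<Sum>b\<leftarrow>[0..<length K]. - (if i = K ! b then dxs (map of_int (K[b := m])) I else 0))
    = - (\<Sum>b<length K. if (of_int i :: 7) = map of_int K ! b then dxs ((map of_int K)[b := of_int m]) I else 0)"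
    unfolding interv_sum_list_conv_sum_set_nat set_upt atLeast0LessThan sum_negf[symmetric]
  proof (rule sum.cong[OF refl])
    fix b assume b: "b \<in> {..<length K}"
    then have "K ! b \<in> set K" by simp
    then have "K ! b \<in> {1..7}" using assms Cons by auto
    then show "- (if i = K ! b then dxs (map of_int (K[b := m])) I else 0)
      = - (if (of_int i :: 7) = map of_int K ! b then dxs ((map of_int K)[b := of_int m]) I else 0)"
      using b of_int_7_eq_iff[OF assms(2), of "K ! b"] by (simp add: map_update)
  qed
  then show ?thesis
    using assms Cons of_int_7_eq_iff[OF assms(2), of m] by (simp add: dxs_Cons_Cons *)
qed

lemma val_contract_terms:
  assumes "in_range P" "i \<in> {1..7}"
  shows "val (contract_terms i P) I = val P (of_int i # I)"
  using assms(1) by (induction P) (auto simp: contract_terms_def val_contract_list[OF _ assms(2)])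

lemma in_range_contract_terms:
  assumes "in_range P"
  shows "in_range (contract_terms i P)"
proof -
  have "in_range (contract_list i l)" if "set l \<subseteq> {1..7}" for l
  proof (cases l)
    case (Cons m J)
    then have "set (J[b := m]) \<subseteq> {1..7}" for b
      using that set_update_subset_insert[of J b m] by auto
    then show ?thesis using that Cons by (auto simp: in_range_def)
  qed simp
  then show ?thesis
    using assms by (induction P) (auto simp: contract_terms_def)
qed

lemma val_empty_list: "val P [] = of_int (\<Sum>(c, l)\<leftarrow>P. if l = [] then c else 0)"
  by (induction P) (auto simp: dxs_length)

text \<open>Only rearrangements of \<open>K\<close> contribute, all with the same signed value; the
  resulting factorial cancels the one in the Hodge star.\<close>

lemma sum_dxs_contract:
  "(\<Sum>I | length I = length K. dxs K I * dxs N (I @ J)) = fact (length K) * dxs (N :: 'n::finite list) (K @ J)"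
proof -
  have "(\<Sum>I | length I = length K. dxs K I * dxs N (I @ J))
      = (\<Sum>\<sigma> | \<sigma> permutes {..<length K}. \<Sum>I | length I = length K.
           if I = permute_list \<sigma> K then of_int (sign \<sigma>) * dxs N (permute_list \<sigma> K @ J) else 0)"
    unfolding dxs_def[of K] sum_distrib_right by (subst sum.swap) (intro sum.cong refl, auto)
  also have "\<dots> = (\<Sum>\<sigma> | \<sigma> permutes {..<length K}. dxs N (K @ J))"
  proof (rule sum.cong[OF refl])
    fix \<sigma> assume "\<sigma> \<in> {\<sigma>. \<sigma> permutes {..<length K}}"
    then have "of_int (sign \<sigma>) * dxs N (permute_list \<sigma> K @ J) = dxs N (K @ J)"
      unfolding dxs_sym[of N] by (simp add: dxs_append_permute_left sign_mult_self_left)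
    then show "(\<Sum>I | length I = length K. if I = permute_list \<sigma> K
        then of_int (sign \<sigma>) * dxs N (permute_list \<sigma> K @ J) else 0) = dxs N (K @ J)"
      unfolding sum.delta[OF finite_lists_length] by simp
  qed
  also have "\<dots> = fact (length K) * dxs N (K @ J)"
    by (simp add: card_permutations)
  finally show ?thesis .
qed

section \<open>The model structure\<close>

definition model_terms :: "(int \<times> int list) list" where
  "model_terms = [(1, [1,2,3]), (1, [1,4,5]), (1, [1,6,7]), (1, [2,4,6]),
     (-1, [2,5,7]), (-1, [3,4,7]), (-1, [3,5,6])]"

text \<open>Minus the contractions of \<open>dx\<^bsup>1\<^esup> \<and> \<dots> \<and> dx\<^bsup>7\<^esup>\<close> with the terms of the model 3-form: the model
  induces the orientation opposite to the order of the coordinates.\<close>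

definition dual_terms :: "(int \<times> int list) list" where
  "dual_terms = concat (map (\<lambda>(c, K). smult_terms (- c)
     (contract_terms (K ! 2) (contract_terms (K ! 1) (contract_terms (K ! 0) [(1, [1..7])])))) model_terms)"

text \<open>The component phi_{mla} of the model form, read off as the coefficient left after three
  contractions; for fixed \<open>m\<close> this is, up to sign, the matrix of the cross product with
  the \<open>m\<close>-th basis vector.\<close>

definition model_matrix :: "int \<Rightarrow> int \<Rightarrow> int \<Rightarrow> int" where
  "model_matrix m l a = (\<Sum>(c, k)\<leftarrow>contract_terms a (contract_terms l (contract_terms m model_terms)).
     if k = [] then c else 0)"

text \<open>The polarised form of the defining relation of the metric on pairs of basis vectors. It
  shows that the model induces the standard inner product; 6 in place of -6 reverses the
  orientation.\<close>

lemma model_terms_check: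
  "list_all (\<lambda>i. list_all (\<lambda>j. vanishes (mult_terms (mult_terms (contract_terms i model_terms)
       (contract_terms j model_terms)) model_terms
     @ smult_terms (-1) (if i = j then [(6, [1..7])] else []))) [1..7]) [1..7]"
  by code_simp

text \<open>H_m . phi_0 = 3 e_m _| psi_0 for the seven basis vectors, where H_m has the entries
  phi_{mla}.\<close>

lemma act_model_terms_check:
  "list_all (\<lambda>m. vanishes (act_terms (model_matrix m) model_terms
     @ smult_terms (-1) (smult_terms 3 (contract_terms m dual_terms)))) [1..7]"
  by code_simp

text \<open>The companion identity H_m . psi_0 = -3 dx^m wedge phi_0, with the same matrices; it is
  the source of the terms in the vector field in the evolution of the dual form.\<close>

lemma act_dual_terms_check:
  "list_all (\<lambda>m. vanishes (act_terms (model_matrix m) dual_terms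
     @ smult_terms (-1) (smult_terms (-3) (mult_terms [(1, [m])] model_terms)))) [1..7]"
  by code_simp

lemma matrix_inv_right:
  fixes A :: "real^'n^'n::finite"
  assumes "invertible A"
  shows "A ** matrix_inv A = mat 1"
  using assms someI_ex[of "\<lambda>B. A ** B = mat 1 \<and> B ** A = mat 1"]
  unfolding invertible_def matrix_inv_def by blast

definition model_4form :: "7 tensor" where
  "model_4form = val dual_terms"

lemma model_3form_eq_val: "model_3form = val model_terms"
  unfolding model_3form_def val_def model_terms_def by (rule ext) simp

lemma in_range_model_terms: "in_range model_terms"
  by (simp add: model_terms_def)

lemma model_terms_subset: "(c, K) \<in> set model_terms \<Longrightarrow> length K = 3 \<and> set K \<subseteq> {1..7}"
  by (auto simp: model_terms_def)

lemma map_of_int_upto: "map of_int [1..7] = [1, 2, 3, 4, 5, 6, 7 :: 7]"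
proof -
  have "[1..7] = [1, 2, 3, 4, 5, 6, 7 :: int]" by code_simp
  then show ?thesis by simp
qed

lemma in_range_top: "in_range [(1, [1..7])]"
  by (simp add: set_upto del: upto_rec_numeral)

lemma in_range_dual_terms: "in_range dual_terms"
proof -
  have "in_range (concat (map (\<lambda>(c, K). smult_terms (- c) (contract_terms (K ! 2)
    (contract_terms (K ! 1) (contract_terms (K ! 0) [(1, [1..7])])))) P))" for P
    by (induction P) (auto simp: in_range_top in_range_contract_terms simp del: upto_rec_numeral)
  then show ?thesis unfolding dual_terms_def .
qed

lemma model_3form_Cons:
  "i \<in> {1..7} \<Longrightarrow> model_3form (of_int i # I) = val (contract_terms i model_terms) I"
  unfolding model_3form_eq_val by (rule val_contract_terms[OF in_range_model_terms, symmetric])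

lemma model_4form_Cons:
  "i \<in> {1..7} \<Longrightarrow> model_4form (of_int i # I) = val (contract_terms i dual_terms) I"
  unfolding model_4form_def by (rule val_contract_terms[OF in_range_dual_terms, symmetric])

lemma model_3form_degree: "length I \<noteq> 3 \<Longrightarrow> model_3form I = 0"
  by (simp add: model_3form_def dxs_length)

lemma wedge_model_3form:
  "wedge (wedge (interior_product u model_3form) (interior_product v model_3form)) model_3form K
    = 6 * (u \<bullet> v) * dxs [1, 2, 3, 4, 5, 6, 7] K"
proof -
  let ?S = "{1..7 :: int}"
  let ?c = "\<lambda>i. val (contract_terms i model_terms)"
  have int: "interior_product w model_3form = (\<lambda>I. \<Sum>i\<in>?S. w $ of_int i * ?c i I)" for w
    unfolding interior_product_def sum_7 by (intro ext sum.cong refl) (simp only: model_3form_Cons)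
  have chk: "val (mult_terms (mult_terms (contract_terms i model_terms) (contract_terms j model_terms)) model_terms) K
      = val (if i = j then [(6, [1..7])] else []) K" if "i \<in> ?S" "j \<in> ?S" for i j
    using model_terms_check that by (intro val_eqI) (simp add: list_all_iff set_upto del: upto_rec_numeral)
  have "wedge (wedge (interior_product u model_3form) (interior_product v model_3form)) model_3form K
      = (\<Sum>i\<in>?S. u $ of_int i * (\<Sum>j\<in>?S. v $ of_int j * wedge (wedge (?c i) (?c j)) (val model_terms) K))"
    unfolding int[of u] int[of v] ext[of "wedge (\<lambda>I. \<Sum>i\<in>?S. u $ of_int i * ?c i I) _", OF wedge_sum_left]
      wedge_sum_left ext[of "wedge _ (\<lambda>I. \<Sum>i\<in>?S. v $ of_int i * ?c i I)", OF wedge_sum_right]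
    by (simp only: model_3form_eq_val)
  also have "\<dots> = (\<Sum>i\<in>?S. u $ of_int i * (\<Sum>j\<in>?S. if j = i then v $ of_int j * (6 * dxs [1, 2, 3, 4, 5, 6, 7] K) else 0))"
  proof (intro sum.cong refl arg_cong[where f = "(*) _"])
    fix i j assume ij: "i \<in> ?S" "j \<in> ?S"
    have "wedge (wedge (?c i) (?c j)) (val model_terms) K
        = val (mult_terms (mult_terms (contract_terms i model_terms) (contract_terms j model_terms)) model_terms) K"
      unfolding ext[of "wedge (?c i) (?c j)", OF wedge_val] by (rule wedge_val)
    also have "\<dots> = (if j = i then 6 * dxs [1, 2, 3, 4, 5, 6, 7] K else 0)"
      unfolding chk[OF ij] map_of_int_upto[symmetric] by (simp del: upto_rec_numeral)
    finally show "v $ of_int j * wedge (wedge (?c i) (?c j)) (val model_terms) K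
        = (if j = i then v $ of_int j * (6 * dxs [1, 2, 3, 4, 5, 6, 7] K) else 0)" by simp
  qed
  also have "\<dots> = 6 * (u \<bullet> v) * dxs [1, 2, 3, 4, 5, 6, 7] K"
    unfolding inner_vec_def sum_7 by (simp add: sum_distrib_left sum_distrib_right mult_ac)
  finally show ?thesis .
qed

text \<open>The skew matrix whose action on the model 3-form is the contraction of the model 4-form with
  \<^term>\<open>Y\<close>; hence the term of the flow with the vector field also comes from a linear action.\<close>

definition vector_matrix :: "real^7 \<Rightarrow> real^7^7" where
  "vector_matrix Y = (\<chi> l a. \<Sum>m\<in>UNIV. (Y $ m / 3) * model_3form [m, l, a])"

lemma act_sum_matrix:
  "act (\<chi> l a. \<Sum>m\<in>S. c m * H m $ l $ a) \<alpha> I = (\<Sum>m\<in>S. c m * act (H m) \<alpha> I)"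
proof -
  have "(\<Sum>m\<in>S. c m * act (H m) \<alpha> I)
    = (\<Sum>m\<in>S. \<Sum>k<length I. \<Sum>l\<in>UNIV. c m * (H m $ l $ (I ! k) * \<alpha> (I[k := l])))"
    unfolding act_def sum_distrib_left ..
  also have "\<dots> = (\<Sum>k<length I. \<Sum>l\<in>UNIV. \<Sum>m\<in>S. c m * (H m $ l $ (I ! k) * \<alpha> (I[k := l])))"
    by (subst sum.swap, rule sum.cong[OF refl], rule sum.swap)
  finally show ?thesis
    unfolding act_def by (simp add: sum_distrib_right mult.assoc)
qed

lemma model_matrix_entry:
  assumes "m \<in> {1..7}" "l \<in> {1..7}" "a \<in> {1..7}"
  shows "model_3form [of_int m, of_int l, of_int a] = of_int (model_matrix m l a)"
  unfolding model_matrix_def val_empty_list[symmetric] model_3form_Cons[OF assms(1)]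
  by (simp only: val_contract_terms in_range_contract_terms in_range_model_terms assms)

text \<open>Linearity in \<open>Y\<close> leaves one check per basis vector; the 3 in the hypothesis
  cancels the division by 3 in \<open>vector_matrix\<close>.\<close>

lemma act_vector_matrix_val:
  assumes P: "in_range P"
    and Q: "\<And>m. m \<in> {1..7} \<Longrightarrow> vanishes (act_terms (model_matrix m) P @ smult_terms (-1) (smult_terms 3 (Q m)))"
  shows "act (vector_matrix Y) (val P) I = (\<Sum>m\<in>{1..7}. Y $ of_int m * val (Q m) I)"
proof -
  have 1: "act (\<chi> l a. model_3form [of_int m, l, a]) (val P) I = 3 * val (Q m) I"
    if m: "m \<in> {1..7}" for m
  proof -
    have "act (\<chi> l a. model_3form [of_int m, l, a]) (val P) I = val (act_terms (model_matrix m) P) I"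
      by (rule act_val[OF _ sum_7 P]) (simp only: vec_lambda_beta model_matrix_entry m)
    also have "\<dots> = val (smult_terms 3 (Q m)) I"
      by (rule val_eqI[OF Q[OF m]])
    finally show ?thesis by simp
  qed
  have "vector_matrix Y = (\<chi> l a. \<Sum>m\<in>UNIV. (Y $ m / 3) * (\<chi> l a. model_3form [m, l, a]) $ l $ a)"
    by (simp add: vector_matrix_def)
  then have "act (vector_matrix Y) (val P) I
      = (\<Sum>m\<in>UNIV. (Y $ m / 3) * act (\<chi> l a. model_3form [m, l, a]) (val P) I)"
    by (simp only: act_sum_matrix)
  also have "\<dots> = (\<Sum>m\<in>{1..7}. Y $ of_int m * val (Q m) I)"
    unfolding sum_7 by (intro sum.cong refl) (simp add: 1)
  finally show ?thesis .
qed

lemma act_model_3form: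
  "act (vector_matrix Y) model_3form I = interior_product Y model_4form I"
proof -
  have "act (vector_matrix Y) model_3form I
      = (\<Sum>m\<in>{1..7}. Y $ of_int m * val (contract_terms m dual_terms) I)"
    unfolding model_3form_eq_val using act_model_terms_check
    by (intro act_vector_matrix_val in_range_model_terms)
       (simp add: list_all_iff set_upto del: upto_rec_numeral)
  also have "\<dots> = interior_product Y model_4form I"
    unfolding interior_product_def sum_7 by (intro sum.cong refl) (simp only: model_4form_Cons)
  finally show ?thesis .
qed

lemma dxs_Cons_Cons_right:
  "dxs (m # J) (i # I) = (if m = i then dxs J I else 0)
     - (\<Sum>b<length I. if m = I ! b then dxs J (I[b := i]) else 0)"
  by (subst dxs_sym, subst dxs_Cons_Cons) (simp only: dxs_sym[of _ J])

lemma wedge_dxs_val: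
  "wedge (dxs [m]) (val P) (i # I)
    = (if m = i then val P I else 0) - (\<Sum>b<length I. if m = I ! b then val P (I[b := i]) else 0)"
proof -
  have "wedge (dxs [m]) (val P) (i # I)
      = (\<Sum>x<length P. of_int (fst (P ! x)) * dxs (m # map of_int (snd (P ! x))) (i # I))"
    unfolding val_eq_sum[of P] wedge_sum_right wedge_dxs by simp
  also have "\<dots> = (\<Sum>x<length P. of_int (fst (P ! x)) * ((if m = i then dxs (map of_int (snd (P ! x))) I else 0)
      - (\<Sum>b<length I. if m = I ! b then dxs (map of_int (snd (P ! x))) (I[b := i]) else 0)))"
    unfolding dxs_Cons_Cons_right ..
  also have "\<dots> = (if m = i then val P I else 0) - (\<Sum>b<length I. if m = I ! b then val P (I[b := i]) else 0)"
    unfolding val_eq_sum[of P] right_diff_distrib sum_subtractf sum_distrib_left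
    by (subst sum.swap) (auto intro!: arg_cong2[of _ _ _ _ "(-)"] sum.cong)
  finally show ?thesis .
qed

text \<open>The right side is - Y wedge phi_0, expanded so that the first index replaces the one
  consumed by \<open>Y\<close>. No index changes its place, which keeps the later pullback
  simple.\<close>

lemma act_model_4form:
  "act (vector_matrix Y) model_4form (i # I)
    = - (Y $ i * model_3form I) + (\<Sum>b<length I. Y $ (I ! b) * model_3form (I[b := i]))"
proof -
  have "act (vector_matrix Y) model_4form (i # I)
      = (\<Sum>m\<in>{1..7}. Y $ of_int m * val (smult_terms (-1) (mult_terms [(1, [m])] model_terms)) (i # I))"
    unfolding model_4form_def
  proof (rule act_vector_matrix_val[OF in_range_dual_terms])
    fix m :: int assume m: "m \<in> {1..7}"
    have "smult_terms (-3) P = smult_terms 3 (smult_terms (-1) P)" for P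
      by (simp add: smult_terms_def case_prod_unfold)
    then show "vanishes (act_terms (model_matrix m) dual_terms @ smult_terms (-1)
        (smult_terms 3 (smult_terms (-1) (mult_terms [(1, [m])] model_terms))))"
      using act_dual_terms_check m by (simp add: list_all_iff set_upto del: upto_rec_numeral)
  qed
  also have "\<dots> = (\<Sum>m\<in>{1..7}. Y $ of_int m * - wedge (dxs [of_int m]) (val model_terms) (i # I))"
  proof -
    have "val [(1, [m])] = dxs [of_int m]" for m by (rule ext) simp
    then show ?thesis using wedge_val[of "[(1, [_])]" model_terms "i # I"] by simp
  qed
  also have "\<dots> = (\<Sum>m\<in>UNIV. - (if m = i then Y $ m * model_3form I else 0)
      + (\<Sum>b<length I. if m = I ! b then Y $ m * model_3form (I[b := i]) else 0))"
    unfolding sum_7 wedge_dxs_val model_3form_eq_val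
    by (intro sum.cong refl) (auto simp: right_diff_distrib sum_distrib_left intro!: sum.cong)
  also have "\<dots> = - (Y $ i * model_3form I) + (\<Sum>b<length I. \<Sum>m\<in>UNIV. if m = I ! b then Y $ m * model_3form (I[b := i]) else 0)"
    unfolding sum.distrib sum_negf by (subst sum.swap) simp
  finally show ?thesis by simp
qed

text \<open>Each term of the 3-form is met 3! times in the sum over \<open>I\<close>, which cancels
  the denominator. What remains are components of the top form with three leading indices, exactly
  the triple contractions in \<open>dual_terms\<close>; the orientation sign -1 gives the minus sign
  there.\<close>

lemma hodge_star_model:
  assumes J: "length J = 4"
  shows "hodge_star (mat 1) (-1) model_3form J = model_4form J"
proof -
  let ?N = "[1, 2, 3, 4, 5, 6, 7 :: 7]"
  have inv: "matrix_inv (mat 1 :: real^7^7) = mat 1"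
    using matrix_inv_right[of "mat 1 :: real^7^7"] by (simp add: invertible_def)
  have "hodge_star (mat 1) (-1) model_3form J
      = - (\<Sum>I | length I = 3. val model_terms I * dxs ?N (I @ J)) / 6"
  proof -
    have "length I + length J = 7 \<longleftrightarrow> length I = 3" for I :: "7 list" using J by auto
    then show ?thesis
      unfolding hodge_star_def raise_all_pullback inv volume_form_def model_3form_eq_val
      by (simp add: J transpose_mat fact_numeral sum_negf)
  qed
  also have "\<dots> = - (\<Sum>(c, K)\<leftarrow>model_terms. of_int c * dxs ?N (map of_int K @ J))"
  proof -
    \<comment> \<open>Stated for an arbitrary list \<open>P\<close> of terms of degree 3, to allow
      induction over the terms.\<close>
    have "(\<Sum>I | length I = 3. val P I * dxs ?N (I @ J)) / 6 = (\<Sum>(c, K)\<leftarrow>P. of_int c * dxs ?N (map of_int K @ J))"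
      if "\<And>c K. (c, K) \<in> set P \<Longrightarrow> length K = 3" for P
      using that
    proof (induction P)
      case (Cons x P)
      obtain c K where x: "x = (c, K)" by (cases x)
      have "(\<Sum>I | length I = 3. dxs (map of_int K) I * dxs ?N (I @ J)) = 6 * dxs ?N (map of_int K @ J)"
        using sum_dxs_contract[of "map of_int K" ?N J] Cons.prems[of c K] x by (simp add: fact_numeral)
      then have "(\<Sum>I | length I = 3. of_int c * dxs (map of_int K) I * dxs ?N (I @ J))
          = of_int c * (6 * dxs ?N (map of_int K @ J))"
        unfolding mult.assoc sum_distrib_left[symmetric] by simp
      moreover have "(\<Sum>I | length I = 3. val P I * dxs ?N (I @ J)) / 6
          = (\<Sum>(c, K)\<leftarrow>P. of_int c * dxs ?N (map of_int K @ J))"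
        by (rule Cons.IH[OF Cons.prems[OF list.set_intros(2)]])
      ultimately show ?case
        by (simp add: x distrib_right sum.distrib add_divide_distrib)
    qed simp
    then show ?thesis using model_terms_subset by (simp only: minus_divide_left[symmetric])
  qed
  also have "\<dots> = model_4form J"
  proof -
    have "val (concat (map (\<lambda>(c, K). smult_terms (- c) (contract_terms (K ! 2)
        (contract_terms (K ! 1) (contract_terms (K ! 0) [(1, [1..7])])))) P)) J
      = - (\<Sum>(c, K)\<leftarrow>P. of_int c * dxs ?N (map of_int K @ J))"
      if "\<And>c K. (c, K) \<in> set P \<Longrightarrow> length K = 3 \<and> set K \<subseteq> {1..7}" for P
      using that
    proof (induction P)
      case (Cons x P)
      obtain c K where x: "x = (c, K)" by (cases x)
      then have K3: "length K = 3" and K: "set K \<subseteq> {1..7}" using Cons.prems by auto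
      have "K ! i \<in> {1..7}" if "i < 3" for i
        by (rule subsetD[OF K], rule nth_mem) (simp add: K3 that)
      then have r: "K ! 0 \<in> {1..7}" "K ! 1 \<in> {1..7}" "K ! 2 \<in> {1..7}"
        by simp_all
      have m: "map of_int K = [of_int (K ! 0), of_int (K ! 1), of_int (K ! 2) :: 7]"
        using K3 by (auto simp: numeral_3_eq_3 length_Suc_conv)
      have "val (contract_terms (K ! 2) (contract_terms (K ! 1) (contract_terms (K ! 0) [(1, [1..7])]))) J
          = dxs ?N (map of_int K @ J)"
        unfolding m by (simp only: val_contract_terms in_range_contract_terms in_range_top r
            val_Cons val_Nil map_of_int_upto append_Cons append_Nil)
      moreover note Cons.IH[OF Cons.prems[OF list.set_intros(2)]]
      ultimately show ?case by (simp add: x del: upto_rec_numeral)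
    qed simp
    from this[OF model_terms_subset] show ?thesis
      unfolding model_4form_def dual_terms_def by simp
  qed
  finally show ?thesis .
qed

section \<open>Determinants and induced structures\<close>

text \<open>The bijection from positions to indices given by \<open>N\<close> turns the permutations
  of positions in \<open>dxs\<close> into the permutations of the index type in the Leibniz
  formula.\<close>

lemma pullback_dxs_eq_det:
  fixes N :: "'n::finite list"
  assumes N: "distinct N" "set N = UNIV" and I: "length I = length N"
  shows "pullback A (dxs N) I = det (\<chi> i j. A $ j $ (I ! inv_into {..<length N} ((!) N) i))"
proof -
  let ?n = "length N"
  let ?pos = "inv_into {..<?n} ((!) N)"
  have inj: "inj_on ((!) N) {..<?n}" using N(1) by (simp add: inj_on_nth)
  have im: "(!) N ` {..<?n} = UNIV" using N(2) by (force simp: set_conv_nth image_iff)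
  have bij: "bij_betw ((!) N) {..<?n} UNIV" using inj im by (simp add: bij_betw_def)
  have pos: "?pos (N ! m) = m" if "m < ?n" for m using inv_into_f_f[OF inj, of m] that by simp
  have "det (\<chi> i j. A $ j $ (I ! ?pos i))
      = (\<Sum>\<sigma> | \<sigma> permutes {..<?n}. of_int (sign \<sigma>) * (\<Prod>i\<in>UNIV. A $ (map_permutation {..<?n} ((!) N) \<sigma> i) $ (I ! ?pos i)))"
    unfolding det_def sum_permutations_map[OF bij]
    by (intro sum.cong refl) (simp add: sign_map_permutation[OF inj])
  also have "\<dots> = (\<Sum>\<sigma> | \<sigma> permutes {..<?n}. of_int (sign \<sigma>) * (\<Prod>m<?n. A $ (N ! \<sigma> m) $ (I ! m)))"
  proof (intro sum.cong refl arg_cong2[of _ _ _ _ "(*)"])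
    fix \<sigma> assume "\<sigma> \<in> {\<sigma>. \<sigma> permutes {..<?n}}"
    have "(\<Prod>i\<in>UNIV. A $ (map_permutation {..<?n} ((!) N) \<sigma> i) $ (I ! ?pos i))
        = (\<Prod>m<?n. A $ (map_permutation {..<?n} ((!) N) \<sigma> (N ! m)) $ (I ! ?pos (N ! m)))"
      using prod.reindex_bij_betw[OF bij, of "\<lambda>i. A $ (map_permutation {..<?n} ((!) N) \<sigma> i) $ (I ! ?pos i)"] by simp
    also have "\<dots> = (\<Prod>m<?n. A $ (N ! \<sigma> m) $ (I ! m))"
      by (intro prod.cong refl) (simp add: pos map_permutation_apply[OF inj])
    finally show "(\<Prod>i\<in>UNIV. A $ (map_permutation {..<?n} ((!) N) \<sigma> i) $ (I ! ?pos i))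
        = (\<Prod>m<?n. A $ (N ! \<sigma> m) $ (I ! m))" .
  qed
  also have "\<dots> = (\<Sum>\<sigma> | \<sigma> permutes {..<?n}. \<Sum>J | length J = ?n.
      if J = permute_list \<sigma> N then (\<Prod>m<?n. A $ (J ! m) $ (I ! m)) * of_int (sign \<sigma>) else 0)"
  proof (rule sum.cong[OF refl])
    fix \<sigma> assume "\<sigma> \<in> {\<sigma>. \<sigma> permutes {..<?n}}"
    then have \<sigma>: "\<sigma> permutes {..<?n}" by simp
    show "of_int (sign \<sigma>) * (\<Prod>m<?n. A $ (N ! \<sigma> m) $ (I ! m)) = (\<Sum>J | length J = ?n.
      if J = permute_list \<sigma> N then (\<Prod>m<?n. A $ (J ! m) $ (I ! m)) * of_int (sign \<sigma>) else 0)"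
      unfolding sum.delta[OF finite_lists_length] by (simp add: permute_list_nth[OF \<sigma>])
  qed
  also have "\<dots> = pullback A (dxs N) I"
    unfolding pullback_def dxs_def sum_distrib_left I
    by (subst sum.swap) (intro sum.cong refl, auto)
  finally show ?thesis ..
qed

lemma pullback_dxs_det:
  fixes N :: "'n::finite list"
  assumes N: "distinct N" "set N = UNIV"
  shows "pullback A (dxs N) I = det A * dxs N I"
proof (cases "length I = length N")
  case True
  define f where "f i = I ! inv_into {..<length N} ((!) N) i" for i
  have *: "pullback B (dxs N) I = det (\<chi> i j. B $ j $ f i)" for B
    unfolding f_def by (rule pullback_dxs_eq_det[OF N True])
  \<comment> \<open>The left factor selects the indices of \<open>I\<close>, and its determinant is
    the case \<open>A = mat 1\<close>, which is \<open>dxs N I\<close>. Repeated indices therefore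
    need no separate treatment.\<close>
  have "(\<chi> i j. A $ j $ f i) = (\<chi> i j. (mat 1 :: real^'n^'n) $ j $ f i) ** transpose A"
  proof -
    have "(\<Sum>k\<in>UNIV. (if k = f i then 1 else 0) * A $ j $ k) = A $ j $ f i" for i j
      by (simp add: if_distrib[of "\<lambda>x. x * _"] cong: if_cong)
    then show ?thesis by (simp add: vec_eq_iff matrix_matrix_mult_def transpose_def mat_def)
  qed
  then have "pullback A (dxs N) I = pullback (mat 1) (dxs N) I * det A"
    unfolding * by (simp add: det_mul)
  then show ?thesis by simp
next
  case False
  then show ?thesis by (simp add: pullback_def dxs_length)
qed

lemma indices_7: "distinct [1, 2, 3, 4, 5, 6, 7 :: 7]" "set [1, 2, 3, 4, 5, 6, 7 :: 7] = UNIV"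
proof -
  show d: "distinct [1, 2, 3, 4, 5, 6, 7 :: 7]" by simp
  show "set [1, 2, 3, 4, 5, 6, 7 :: 7] = UNIV"
    by (rule card_subset_eq) (simp_all add: distinct_card[OF d] del: set_simps)
qed

section \<open>Positive definite matrices\<close>

lemma inner_product_matrix_transpose_mult:
  fixes A :: "real^'n^'n::finite"
  assumes "invertible A"
  shows "inner_product_matrix (transpose A ** A)"
  unfolding inner_product_matrix_def
proof (intro conjI allI impI)
  show "transpose (transpose A ** A) = transpose A ** A"
    by (simp add: matrix_transpose_mul)
  fix v :: "real^'n" assume "v \<noteq> 0"
  then have "A *v v \<noteq> 0"
    using assms by (metis invertible_def matrix_left_invertible_ker)
  moreover have "v \<bullet> ((transpose A ** A) *v v) = (A *v v) \<bullet> (A *v v)"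
    by (metis dot_lmul_matrix inner_commute matrix_vector_mul_assoc vector_transpose_matrix transpose_transpose)
  ultimately show "v \<bullet> ((transpose A ** A) *v v) > 0" by simp
qed

text \<open>The segment from the identity to \<open>g\<close> consists of positive definite
  matrices, so the determinant has no zero along it and keeps the sign it has at the
  identity.\<close>

lemma inner_product_matrix_det_pos:
  fixes g :: "real^'n^'n::finite"
  assumes g: "inner_product_matrix g"
  shows "det g > 0"
proof (rule ccontr)
  assume neg: "\<not> det g > 0"
  define p where "p s = (1 - s) *\<^sub>R mat 1 + s *\<^sub>R g" for s :: real
  have cont: "continuous_on {0..1} (\<lambda>s. det (p s))"
    unfolding p_def det_def by (intro continuous_intros)
  have "det (p 1) \<le> 0" "0 \<le> det (p 0)" using neg by (simp_all add: p_def)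
  then obtain s where s: "0 \<le> s" "s \<le> 1" "det (p s) = 0"
    using IVT2'[OF _ _ _ cont, of 0] by auto
  then have "\<not> invertible (p s)" by (simp add: invertible_det_nz)
  then obtain v where v: "v \<noteq> 0" "p s *v v = 0"
    by (metis invertible_left_inverse matrix_left_invertible_ker)
  have "v \<bullet> (p s *v v) = (1 - s) * (v \<bullet> v) + s * (v \<bullet> (g *v v))"
    by (simp add: p_def matrix_vector_mult_add_rdistrib inner_add_right scaleR_matrix_vector_assoc[symmetric])
  moreover have "0 < (1 - s) * (v \<bullet> v) + s * (v \<bullet> (g *v v))"
  proof (cases "s = 0")
    case False
    then show ?thesis
      using g v(1) s by (intro add_nonneg_pos mult_nonneg_nonneg mult_pos_pos) (auto simp: inner_product_matrix_def)
  qed (use v in simp)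
  ultimately show False using v(2) by simp
qed

text \<open>The top form is multiplied by \<open>det A\<close>, whereas the square root of the
  determinant of the metric is its absolute value. The sign of \<open>det A\<close> goes into the
  orientation, and the extra minus sign turns the 6 of the model into the -6 of the
  convention.\<close>

lemma G2_induces_pullback:
  assumes A: "invertible A"
  shows "G2_induces (pullback A model_3form) (transpose A ** A) (- sgn (det A))"
  unfolding G2_induces_def
proof (intro conjI allI)
  show "inner_product_matrix (transpose A ** A)"
    by (rule inner_product_matrix_transpose_mult[OF A])
  have d: "det A \<noteq> 0" using A by (simp add: invertible_det_nz)
  then show "- sgn (det A) \<in> {1, -1}" by (auto simp: sgn_if)
  fix u v :: "real^7"
  have uv: "(A *v u) \<bullet> (A *v v) = u \<bullet> ((transpose A ** A) *v v)"
    by (metis dot_lmul_matrix inner_commute matrix_vector_mul_assoc vector_transpose_matrix transpose_transpose)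
  have sq: "sqrt (det (transpose A ** A)) = \<bar>det A\<bar>"
    by (simp add: det_mul)
  show "wedge (wedge (interior_product u (pullback A model_3form)) (interior_product v (pullback A model_3form)))
      (pullback A model_3form) = (\<lambda>I. - 6 * (u \<bullet> ((transpose A ** A) *v v)) * volume_form (transpose A ** A) (- sgn (det A)) I)"
  proof (rule ext)
    fix I
    have "wedge (wedge (interior_product u (pullback A model_3form)) (interior_product v (pullback A model_3form)))
        (pullback A model_3form) I
      = pullback A (\<lambda>I. 6 * ((A *v u) \<bullet> (A *v v)) * dxs [1, 2, 3, 4, 5, 6, 7] I) I"
      unfolding ext[OF interior_product_pullback] ext[OF pullback_wedge] pullback_wedge
        ext[OF wedge_model_3form] ..
    also have "\<dots> = - 6 * (u \<bullet> ((transpose A ** A) *v v)) * volume_form (transpose A ** A) (- sgn (det A)) I"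
      unfolding pullback_scale pullback_dxs_det[OF indices_7] volume_form_def sq uv
      by (simp add: sgn_if abs_if)
    finally show "wedge (wedge (interior_product u (pullback A model_3form)) (interior_product v (pullback A model_3form)))
        (pullback A model_3form) I
      = - 6 * (u \<bullet> ((transpose A ** A) *v v)) * volume_form (transpose A ** A) (- sgn (det A)) I" .
  qed
qed

text \<open>The matrix \<open>-6 w g\<close>, where \<open>w = \<plusminus>sqrt (det g)\<close> is the coefficient of the volume form. Its
  determinant \<open>-6\<^sup>7 w\<^sup>9\<close> determines \<open>w\<close>, and then \<open>g\<close>.\<close>

definition gram :: "7 tensor \<Rightarrow> real^7^7" where
  "gram \<phi> = (\<chi> i j. wedge (wedge (interior_product (axis i 1) \<phi>) (interior_product (axis j 1) \<phi>)) \<phi> [1, 2, 3, 4, 5, 6, 7])"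

definition vol_coeff :: "7 tensor \<Rightarrow> real" where
  "vol_coeff \<phi> = root 9 (- det (gram \<phi>) / 6 ^ 7)"

lemma dxs_indices_7: "dxs [1, 2, 3, 4, 5, 6, 7 :: 7] [1, 2, 3, 4, 5, 6, 7] = 1"
  by (simp add: dxs_Cons_Cons lessThan_Suc numeral_eq_Suc)

lemma G2_induces_gram:
  assumes "G2_induces \<phi> g \<epsilon>"
  defines "w \<equiv> \<epsilon> * sqrt (det g)"
  shows "w = vol_coeff \<phi>" "g $ i $ j = - gram \<phi> $ i $ j / (6 * vol_coeff \<phi>)" "\<epsilon> = sgn (vol_coeff \<phi>)"
    "vol_coeff \<phi> \<noteq> 0" "det (gram \<phi>) \<noteq> 0"
proof -
  have g: "inner_product_matrix g" and \<epsilon>: "\<epsilon> \<in> {1, -1}"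
    and ind: "wedge (wedge (interior_product u \<phi>) (interior_product v \<phi>)) \<phi>
        = (\<lambda>I. - 6 * (u \<bullet> (g *v v)) * volume_form g \<epsilon> I)" for u v
    using assms(1) unfolding G2_induces_def by auto
  have dg: "det g > 0" by (rule inner_product_matrix_det_pos[OF g])
  have \<epsilon>2: "\<epsilon> * \<epsilon> = 1" using \<epsilon> by auto
  have w2: "w ^ 2 = det g" using dg \<epsilon>2 by (simp add: w_def power2_eq_square mult_ac)
  have w0: "w \<noteq> 0" using dg \<epsilon> by (auto simp: w_def)
  have gr: "gram \<phi> $ i $ j = - 6 * w * g $ i $ j" for i j
    by (simp add: gram_def ind volume_form_def dxs_indices_7 w_def inner_axis' matrix_vector_mul_component
        inner_axis)
  have "gram \<phi> = (\<chi> i. (- 6 * w) *s g $ i)"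
    by (simp add: vec_eq_iff gr)
  then have "det (gram \<phi>) = (- 6 * w) ^ 7 * det g"
    using det_rows_mul[of "\<lambda>i. - 6 * w" "\<lambda>i. g $ i"] by simp
  also have "\<dots> = - (6 ^ 7 * w ^ 9)"
    unfolding w2[symmetric] by (simp add: power_mult_distrib flip: power_add)
  finally have dB: "det (gram \<phi>) = - (6 ^ 7 * w ^ 9)" .
  \<comment> \<open>The exponent 9 is odd, so the real root recovers \<open>w\<close> together with
    its sign, hence the orientation as well as the volume.\<close>
  show w: "w = vol_coeff \<phi>"
    unfolding vol_coeff_def dB by (simp add: odd_real_root_power_cancel)
  show "g $ i $ j = - gram \<phi> $ i $ j / (6 * vol_coeff \<phi>)"
    unfolding w[symmetric] gr using w0 by simp
  show "\<epsilon> = sgn (vol_coeff \<phi>)"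
    unfolding w[symmetric] w_def using dg \<epsilon> by (auto simp: sgn_mult)
  show "vol_coeff \<phi> \<noteq> 0" using w0 w by simp
  show "det (gram \<phi>) \<noteq> 0" unfolding dB using w0 by simp
qed

lemma G2_metric_eqI:
  assumes "G2_induces \<phi> g \<epsilon>"
  shows "G2_metric \<phi> = g" "G2_orientation \<phi> = \<epsilon>"
proof -
  have "g' = g" "\<epsilon>' = \<epsilon>" if "G2_induces \<phi> g' \<epsilon>'" for g' \<epsilon>'
    using G2_induces_gram(2,3)[OF assms] G2_induces_gram(2,3)[OF that] by (auto simp: vec_eq_iff)
  then show "G2_metric \<phi> = g" "G2_orientation \<phi> = \<epsilon>"
    unfolding G2_metric_def G2_orientation_def using assms by blast+
qed

text \<open>With the sign \<open>\<epsilon> * sgn (det A)\<close> the volume form of the new metric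
  is the pullback of the old one, and the raised components transform with the inverse transpose of
  \<open>A\<close>; invariance of contractions does the rest.\<close>

lemma hodge_star_pullback:
  assumes A: "invertible A" and J: "length J \<le> 7"
  shows "hodge_star (transpose A ** A) (\<epsilon> * sgn (det A)) (pullback A \<alpha>) J
    = pullback A (hodge_star (mat 1) \<epsilon> \<alpha>) J"
proof -
  let ?g = "transpose A ** A" and ?N = "[1, 2, 3, 4, 5, 6, 7 :: 7]"
  define C where "C = A ** transpose (matrix_inv ?g)"
  have "invertible ?g"
    using A by (simp add: invertible_det_nz det_mul)
  then have "transpose A ** (A ** matrix_inv ?g) = mat 1"
    using matrix_inv_right by (simp add: matrix_mul_assoc)
  then have "(A ** matrix_inv ?g) ** transpose A = mat 1"
    by (simp only: matrix_left_right_inverse)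
  then have AC: "A ** transpose C = mat 1"
    by (simp add: C_def matrix_transpose_mul matrix_mul_assoc)
  have raise: "raise_all ?g (pullback A \<alpha>) I = pullback C \<alpha> I" for I
    unfolding raise_all_pullback pullback_pullback C_def ..
  have inv: "matrix_inv (mat 1 :: real^7^7) = mat 1"
    using matrix_inv_right[of "mat 1 :: real^7^7"] by (simp add: invertible_def)
  have raise1: "raise_all (mat 1) \<alpha> I = \<alpha> I" for I
    unfolding raise_all_pullback inv by (simp add: transpose_mat)
  have sq: "sqrt (det ?g) = \<bar>det A\<bar>" by (simp add: det_mul)
  have vol: "volume_form ?g (\<epsilon> * sgn (det A)) = pullback A (volume_form (mat 1) \<epsilon>)"
    unfolding volume_form_def sq pullback_scale pullback_dxs_det[OF indices_7] ext[OF pullback_scale]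
    by (rule ext) (auto simp: pullback_scale pullback_dxs_det[OF indices_7] abs_sgn mult_ac)
  \<comment> \<open>The bound on \<open>length J\<close> guards the subtraction of natural
    numbers.\<close>
  have len: "length I + length K = 7 \<longleftrightarrow> length I = 7 - length J" if "length K = length J" for I K :: "7 list"
    using J that by auto
  have "hodge_star ?g (\<epsilon> * sgn (det A)) (pullback A \<alpha>) J
      = (\<Sum>I | length I = 7 - length J. pullback C \<alpha> I * pullback A (volume_form (mat 1) \<epsilon>) (I @ J)) / fact (7 - length J)"
    unfolding hodge_star_def raise vol len[OF refl] ..
  also have "\<dots> = pullback A (\<lambda>K. (\<Sum>I | length I = 7 - length J. \<alpha> I * volume_form (mat 1) \<epsilon> (I @ K)) / fact (7 - length J)) J"
    unfolding sum_pullback_contract[OF AC] pullback_divide ..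
  also have "\<dots> = pullback A (hodge_star (mat 1) \<epsilon> \<alpha>) J"
    by (rule pullback_cong) (simp add: hodge_star_def raise1 len)
  finally show ?thesis .
qed

lemma G2_dual_pullback:
  assumes A: "invertible A" and J: "length J = 4"
  shows "G2_dual (pullback A model_3form) J = pullback A model_4form J"
proof -
  have "G2_dual (pullback A model_3form) J = pullback A (hodge_star (mat 1) (-1) model_3form) J"
    unfolding G2_dual_def G2_metric_eqI[OF G2_induces_pullback[OF A]]
    using hodge_star_pullback[OF A, of J "-1"] J by simp
  also have "\<dots> = pullback A model_4form J"
    by (rule pullback_cong) (simp add: hodge_star_model J)
  finally show ?thesis .
qed

section \<open>Curves with the same first-order jet\<close>

text \<open>The first curve need only be defined on \<^term>\<open>T\<close>; the second one is defined near \<^term>\<open>t\<close>, so that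
  its derivative is unique even if \<^term>\<open>t\<close> is an end point of \<^term>\<open>T\<close>.\<close>

definition tangent :: "real \<Rightarrow> real set \<Rightarrow> (real \<Rightarrow> real) \<Rightarrow> (real \<Rightarrow> real) \<Rightarrow> bool" where
  "tangent t T f f' \<longleftrightarrow> f t = f' t \<and>
     (\<exists>D. (f has_real_derivative D) (at t within T) \<and> (f' has_real_derivative D) (at t))"

lemma tangentI:
  "f t = f' t \<Longrightarrow> (f has_real_derivative D) (at t within T) \<Longrightarrow> (f' has_real_derivative D) (at t)
    \<Longrightarrow> tangent t T f f'"
  by (auto simp: tangent_def)

lemma tangent_const: "tangent t T (\<lambda>s. c) (\<lambda>s. c)"
  by (rule tangentI[of _ _ _ 0]) auto

lemma tangent_add: "tangent t T f f' \<Longrightarrow> tangent t T k k' \<Longrightarrow> tangent t T (\<lambda>s. f s + k s) (\<lambda>s. f' s + k' s)"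
  unfolding tangent_def by (auto intro: DERIV_add)

lemma tangent_mult:
  assumes "tangent t T f f'" "tangent t T k k'"
  shows "tangent t T (\<lambda>s. f s * k s) (\<lambda>s. f' s * k' s)"
proof -
  obtain D E where "f t = f' t" "k t = k' t"
    "(f has_real_derivative D) (at t within T)" "(f' has_real_derivative D) (at t)"
    "(k has_real_derivative E) (at t within T)" "(k' has_real_derivative E) (at t)"
    using assms by (auto simp: tangent_def)
  then show ?thesis
    using DERIV_mult[of f D t T k E] DERIV_mult[of f' D t UNIV k' E] by (intro tangentI) auto
qed

lemma tangent_sum:
  "(\<And>x. x \<in> S \<Longrightarrow> tangent t T (f x) (f' x)) \<Longrightarrow> tangent t T (\<lambda>s. \<Sum>x\<in>S. f x s) (\<lambda>s. \<Sum>x\<in>S. f' x s)"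
  by (induction S rule: infinite_finite_induct) (auto intro: tangent_const tangent_add)

lemma tangent_prod:
  "(\<And>x. x \<in> S \<Longrightarrow> tangent t T (f x) (f' x)) \<Longrightarrow> tangent t T (\<lambda>s. \<Prod>x\<in>S. f x s) (\<lambda>s. \<Prod>x\<in>S. f' x s)"
  by (induction S rule: infinite_finite_induct) (auto intro: tangent_const tangent_mult)

text \<open>Both curves pass through the same point at time \<open>t\<close>, so a single derivative
  of \<open>F\<close> serves both chain rules.\<close>

lemma tangent_compose:
  assumes "tangent t T f f'" and F: "(F has_real_derivative E) (at (f t))"
  shows "tangent t T (\<lambda>s. F (f s)) (\<lambda>s. F (f' s))"
proof -
  obtain D where D: "f t = f' t" "(f has_real_derivative D) (at t within T)" "(f' has_real_derivative D) (at t)"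
    using assms(1) by (auto simp: tangent_def)
  show ?thesis
    using DERIV_chain2[OF F D(2)] DERIV_chain2[of F E f' t D UNIV] F D by (intro tangentI) auto
qed

lemma tangent_divide:
  assumes "tangent t T f f'" "tangent t T k k'" "k t \<noteq> 0"
  shows "tangent t T (\<lambda>s. f s / k s) (\<lambda>s. f' s / k' s)"
  unfolding divide_inverse
  by (rule tangent_mult[OF assms(1) tangent_compose[OF assms(2) DERIV_inverse[OF assms(3)]]])

lemma tangent_minus: "tangent t T f f' \<Longrightarrow> tangent t T (\<lambda>s. - f s) (\<lambda>s. - f' s)"
  using tangent_mult[OF tangent_const[of t T "-1"]] by simp

lemma tangent_det:
  fixes M M' :: "real \<Rightarrow> real^'n^'n::finite"
  assumes "\<And>i j. tangent t T (\<lambda>s. M s $ i $ j) (\<lambda>s. M' s $ i $ j)"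
  shows "tangent t T (\<lambda>s. det (M s)) (\<lambda>s. det (M' s))"
  unfolding det_def by (intro tangent_sum tangent_mult tangent_const tangent_prod assms)

lemma tangent_wedge:
  assumes "\<And>I. tangent t T (\<lambda>s. \<alpha> s I) (\<lambda>s. \<alpha>' s I)" "\<And>I. tangent t T (\<lambda>s. \<beta> s I) (\<lambda>s. \<beta>' s I)"
  shows "tangent t T (\<lambda>s. wedge (\<alpha> s) (\<beta> s) I) (\<lambda>s. wedge (\<alpha>' s) (\<beta>' s) I)"
  unfolding wedge_def
  by (intro tangent_sum tangent_divide tangent_mult tangent_const assms) simp

lemma tangent_interior_product:
  assumes "\<And>I. tangent t T (\<lambda>s. \<alpha> s I) (\<lambda>s. \<alpha>' s I)"
  shows "tangent t T (\<lambda>s. interior_product u (\<alpha> s) I) (\<lambda>s. interior_product u (\<alpha>' s) I)"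
  unfolding interior_product_def by (intro tangent_sum tangent_mult tangent_const assms)

section \<open>The inverse matrix and the dual form along tangent curves\<close>

lemma matrix_inv_cramer:
  fixes g :: "real^'n^'n::finite"
  assumes "det g \<noteq> 0"
  shows "matrix_inv g $ l $ m = det (\<chi> i j. if j = l then if i = m then 1 else 0 else g $ i $ j) / det g"
proof -
  have "g ** matrix_inv g = mat 1"
    using assms by (intro matrix_inv_right) (simp add: invertible_det_nz)
  then have "g *v column m (matrix_inv g) = axis m 1"
    by (simp add: matrix_vector_mult_def matrix_matrix_mult_def vec_eq_iff column_def mat_def axis_def)
  then have "column m (matrix_inv g) = (\<chi> k. det (\<chi> i j. if j = k then axis m 1 $ i else g $ i $ j) / det g)"
    using cramer[OF assms] by blast
  then show ?thesis
    by (simp add: vec_eq_iff column_def axis_def cong: if_cong)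
qed

text \<open>The Cramer quotient is an explicit expression in the entries at every time, also where
  the determinant may vanish; division needs it nonzero only at \<open>t\<close>.\<close>

lemma tangent_matrix_inv:
  fixes M M' :: "real \<Rightarrow> real^'n^'n::finite"
  assumes M: "\<And>i j. tangent t T (\<lambda>s. M s $ i $ j) (\<lambda>s. M' s $ i $ j)"
    and d: "det (M t) \<noteq> 0"
  defines "C \<equiv> \<lambda>g l m. det (\<chi> i j. if j = l then if i = m then 1 else 0 else g $ i $ j) / det (g :: real^'n^'n)"
  shows "tangent t T (\<lambda>s. C (M s) l m) (\<lambda>s. C (M' s) l m)"
  unfolding C_def
proof (intro tangent_divide tangent_det d M)
  fix i j
  show "tangent t T (\<lambda>s. (\<chi> i j. if j = l then if i = m then 1 else 0 else M s $ i $ j) $ i $ j)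
     (\<lambda>s. (\<chi> i j. if j = l then if i = m then 1 else 0 else M' s $ i $ j) $ i $ j)"
    using M by (cases "j = l") (auto intro: tangent_const)
qed

text \<open>The dual form as an explicit function of the components, with the inverse of the metric given by
  Cramer's rule.\<close>

definition gram_metric :: "7 tensor \<Rightarrow> real^7^7" where
  "gram_metric \<phi> = (\<chi> i j. - gram \<phi> $ i $ j / (6 * vol_coeff \<phi>))"

definition gram_dual :: "7 tensor \<Rightarrow> 7 tensor" where
  "gram_dual \<phi> J = (\<Sum>I | length I + length J = 7. (\<Sum>K | length K = length I. (\<Prod>m<length I.
       det (\<chi> i j. if j = I ! m then if i = K ! m then 1 else 0 else gram_metric \<phi> $ i $ j) / det (gram_metric \<phi>)) * \<phi> K)
     * (vol_coeff \<phi> * dxs [1, 2, 3, 4, 5, 6, 7] (I @ J))) / fact (7 - length J)"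

lemma G2_dual_eq_gram_dual:
  assumes ind: "G2_induces \<phi> g \<epsilon>"
  shows "G2_dual \<phi> J = gram_dual \<phi> J" "gram_metric \<phi> = g"
proof -
  have dg: "det g > 0"
    using ind inner_product_matrix_det_pos by (auto simp: G2_induces_def)
  show g: "gram_metric \<phi> = g"
    using G2_induces_gram(2)[OF ind] by (simp add: gram_metric_def vec_eq_iff)
  show "G2_dual \<phi> J = gram_dual \<phi> J"
    unfolding G2_dual_def G2_metric_eqI[OF ind] gram_dual_def hodge_star_def raise_all_def volume_form_def g
      G2_induces_gram(1)[OF ind, symmetric]
    using dg by (simp only: matrix_inv_cramer[OF less_imp_neq[OF dg, symmetric]])
qed

lemma tangent_gram_dual:
  assumes \<phi>: "\<And>I. tangent t T (\<lambda>s. \<phi> s I) (\<lambda>s. \<phi>' s I)" and ind: "G2_induces (\<phi> t) g \<epsilon>"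
  shows "tangent t T (\<lambda>s. gram_dual (\<phi> s) J) (\<lambda>s. gram_dual (\<phi>' s) J)"
proof -
  note nz = G2_induces_gram(4,5)[OF ind]
  have dg: "det (gram_metric (\<phi> t)) \<noteq> 0"
    using ind inner_product_matrix_det_pos unfolding G2_dual_eq_gram_dual(2)[OF ind]
    by (force simp: G2_induces_def)
  have gram: "tangent t T (\<lambda>s. gram (\<phi> s) $ i $ j) (\<lambda>s. gram (\<phi>' s) $ i $ j)" for i j
    unfolding gram_def vec_lambda_beta by (intro tangent_wedge tangent_interior_product \<phi>)
  have "tangent t T (\<lambda>s. - det (gram (\<phi> s)) / 6 ^ 7) (\<lambda>s. - det (gram (\<phi>' s)) / 6 ^ 7)"
    by (intro tangent_divide tangent_minus tangent_det gram tangent_const) simp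
  \<comment> \<open>The ninth root is differentiable away from 0, and \<open>G2_induces\<close> at
    time \<open>t\<close> makes the determinant of the Gram matrix nonzero.\<close>
  then have vol: "tangent t T (\<lambda>s. vol_coeff (\<phi> s)) (\<lambda>s. vol_coeff (\<phi>' s))"
    unfolding vol_coeff_def
    by (rule tangent_compose[OF _ DERIV_odd_real_root]) (use nz(2) in auto)
  have met: "tangent t T (\<lambda>s. gram_metric (\<phi> s) $ i $ j) (\<lambda>s. gram_metric (\<phi>' s) $ i $ j)" for i j
    unfolding gram_metric_def vec_lambda_beta
    by (intro tangent_divide tangent_minus gram tangent_mult tangent_const vol) (use nz in simp)
  show ?thesis
    unfolding gram_dual_def
    by (intro tangent_divide tangent_sum tangent_mult tangent_prod tangent_const vol \<phi>
        tangent_matrix_inv[of t T "\<lambda>s. gram_metric (\<phi> s)" "\<lambda>s. gram_metric (\<phi>' s)"] met dg) simp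
qed

section \<open>The evolution of the dual form\<close>

text \<open>Exchanging the first index with the one at position \<open>b\<close> produces a tensor
  product of \<theta> and \<alpha>, to which multiplicativity applies.\<close>

lemma pullback_swap_first:
  assumes b: "b < length I"
  shows "pullback A (\<lambda>K. \<theta> [tl K ! b] * \<alpha> ((tl K)[b := hd K])) (i # I)
    = pullback A \<theta> [I ! b] * pullback A \<alpha> (I[b := i])"
proof -
  let ?\<sigma> = "Transposition.transpose 0 (Suc b)"
  let ?F = "\<lambda>K. \<theta> (take 1 K) * \<alpha> (drop 1 K)"
  have "pullback A (\<lambda>K. \<theta> [tl K ! b] * \<alpha> ((tl K)[b := hd K])) (i # I)
      = pullback A (\<lambda>K. ?F (permute_list ?\<sigma> K)) (i # I)"
  proof (rule pullback_cong)
    fix K :: "'a list" assume "length K = length (i # I)"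
    then obtain k L where "K = k # L" "length L = length I" by (cases K) auto
    then show "\<theta> [tl K ! b] * \<alpha> ((tl K)[b := hd K]) = ?F (permute_list ?\<sigma> K)"
      using permute_list_transpose_Cons[of b L k] b by simp
  qed
  also have "\<dots> = pullback A ?F (I ! b # I[b := i])"
    using pullback_permute_list[OF transpose_permutes_Cons[OF b, of i], of A ?F]
    unfolding permute_list_transpose_Cons[OF b] .
  also have "\<dots> = pullback A \<theta> [I ! b] * pullback A \<alpha> (I[b := i])"
    unfolding pullback_take_drop by simp
  finally show ?thesis .
qed

text \<open>The model metric is standard, so \<open>A *v X\<close> is also its own covector; its
  pullback has the components \<open>Z\<close>, which is \<open>X\<close> lowered with the metric
  induced by the pulled back form.\<close>

lemma pullback_act_model_4form:
  fixes A :: "real^7^7" and X :: "real^7"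
  defines "Z \<equiv> (transpose A ** A) *v X"
  shows "pullback A (act (vector_matrix (A *v X)) model_4form) (i # I)
    = - (Z $ i * pullback A model_3form I)
      + (\<Sum>b<length I. Z $ (I ! b) * pullback A model_3form (I[b := i]))"
proof -
  define \<theta> :: "7 tensor" where "\<theta> K = (A *v X) $ hd K" for K
  have \<theta>: "pullback A \<theta> [i] = Z $ i" for i
    by (simp add: pullback_Cons \<theta>_def Z_def matrix_vector_mul_assoc[symmetric] transpose_def
        matrix_vector_mult_def[of "vec_lambda _"])
  have "pullback A (act (vector_matrix (A *v X)) model_4form) (i # I)
      = pullback A (\<lambda>K. - 1 * (\<theta> (take 1 K) * model_3form (drop 1 K))
          + (\<Sum>b<length I. \<theta> [tl K ! b] * model_3form ((tl K)[b := hd K]))) (i # I)"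
  proof (rule pullback_cong)
    fix K :: "7 list" assume "length K = length (i # I)"
    then obtain k L where "K = k # L" "length L = length I" by (cases K) auto
    then show "act (vector_matrix (A *v X)) model_4form K = - 1 * (\<theta> (take 1 K) * model_3form (drop 1 K))
          + (\<Sum>b<length I. \<theta> [tl K ! b] * model_3form ((tl K)[b := hd K]))"
      by (simp add: act_model_4form \<theta>_def)
  qed
  also have "\<dots> = - (Z $ i * pullback A model_3form I)
      + (\<Sum>b<length I. Z $ (I ! b) * pullback A model_3form (I[b := i]))"
    unfolding pullback_add pullback_sum pullback_scale pullback_take_drop
    by (simp add: pullback_swap_first \<theta>)
  finally show ?thesis .
qed

lemma alternating_swap:
  assumes "alternating \<alpha>"
  shows "\<alpha> (xs @ a # b # ys) = - \<alpha> (xs @ b # a # ys)"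
  using assms permute_list_swap(1)[of xs b a ys] unfolding alternating_def
  by (metis permute_list_swap(2,3) of_int_1 of_int_minus mult_minus1)

lemma dual_derivative:
  fixes \<phi> :: "real \<Rightarrow> 7 tensor" and h :: "7 tensor" and X :: "real^7"
  assumes G2: "\<And>s. s \<in> T \<Longrightarrow> G2_form (\<phi> s)" and t: "t \<in> T"
    and flow: "\<And>i j k. ((\<lambda>s. \<phi> s [i, j, k]) has_real_derivative
         (\<Sum>l\<in>UNIV. M l i * \<phi> t [l, j, k] + M l j * \<phi> t [i, l, k] + M l k * \<phi> t [i, j, l]
                  + X $ l * G2_dual (\<phi> t) [l, i, j, k])) (at t within T)"
  defines "Z \<equiv> lower (G2_metric (\<phi> t)) X"
  shows "((\<lambda>s. G2_dual (\<phi> s) [i, j, k, l]) has_real_derivative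
         (\<Sum>m\<in>UNIV. M m i * G2_dual (\<phi> t) [m, j, k, l] + M m j * G2_dual (\<phi> t) [i, m, k, l]
                  + M m k * G2_dual (\<phi> t) [i, j, m, l] + M m l * G2_dual (\<phi> t) [i, j, k, m])
         - Z i * \<phi> t [j, k, l] + Z j * \<phi> t [i, k, l] - Z k * \<phi> t [i, j, l] + Z l * \<phi> t [i, j, k]) (at t within T)"
proof -
  have ind: "\<exists>g \<epsilon>. G2_induces (\<phi> s) g \<epsilon>" if "s \<in> T" for s
  proof -
    obtain A where "invertible A" "\<phi> s = pullback A model_3form"
      using G2[OF \<open>s \<in> T\<close>] by (auto simp: G2_form_def)
    then show ?thesis using G2_induces_pullback[of A] by auto
  qed
  obtain A where A: "invertible A" and \<phi>t: "\<phi> t = pullback A model_3form"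
    using G2[OF t] by (auto simp: G2_form_def)
  have alt: "alternating (\<phi> t)" using G2[OF t] by (simp add: G2_form_def is_form_def)
  define N :: "real^7^7" where "N = (\<chi> l i. M l i)"
  \<comment> \<open>The skew matrix is known on the model only, so \<open>X\<close> is first pushed
    forward by \<open>A\<close>. In \<open>K\<close> the matrix \<open>N\<close> acts after the
    pullback and yields the terms in \<open>M\<close>; \<open>H\<close> acts before it and yields
    the terms in \<open>X\<close>.\<close>
  define H where "H = vector_matrix (A *v X)"
  define K where "K = A ** N + H ** A"
  define \<gamma> where "\<gamma> s = pullback (A + (s - t) *\<^sub>R K) model_3form" for s
  have \<psi>t: "G2_dual (\<phi> t) J = pullback A model_4form J" if "length J = 4" for J
    unfolding \<phi>t by (rule G2_dual_pullback[OF A that])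
  have Z: "Z i = ((transpose A ** A) *v X) $ i" for i
    unfolding Z_def \<phi>t G2_metric_eqI[OF G2_induces_pullback[OF A]] by (simp add: lower_def matrix_vector_mult_def)
  note D = has_derivative_pullback[OF K_def]
  have tan: "tangent t T (\<lambda>s. \<phi> s I) (\<lambda>s. \<gamma> s I)" for I
  proof (cases "length I = 3")
    case True
    then obtain i j k where I: "I = [i, j, k]"
      by (auto simp: numeral_3_eq_3 length_Suc_conv)
    have 1: "pullback A (act H model_3form) I = (\<Sum>l\<in>UNIV. X $ l * G2_dual (\<phi> t) (l # I))"
      unfolding H_def ext[OF act_model_3form] interior_product_pullback[symmetric]
      unfolding interior_product_def by (simp add: \<psi>t I)
    have "act N (pullback A model_3form) I + pullback A (act H model_3form) I
        = (\<Sum>l\<in>UNIV. M l i * \<phi> t [l, j, k] + M l j * \<phi> t [i, l, k] + M l k * \<phi> t [i, j, l]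
                  + X $ l * G2_dual (\<phi> t) [l, i, j, k])"
      unfolding 1 \<phi>t[symmetric] unfolding I by (simp add: act_Cons N_def sum.distrib)
    then show ?thesis
      using flow[of i j k] D[of t model_3form I] unfolding \<gamma>_def I
      by (intro tangentI) (simp_all add: \<phi>t)
  next
    \<comment> \<open>\<open>gram_dual\<close> is built from wedge products, which sum over all
      splittings of the index list, so the jets are compared on lists of every length; for lengths
      other than 3 both curves vanish on their domains.\<close>
    case False
    have "((\<lambda>s. \<phi> s I) has_real_derivative 0) (at t within T)"
    proof (rule has_field_derivative_transform_within[OF _ zero_less_one t])
      show "((\<lambda>s. 0) has_real_derivative 0) (at t within T)" by simp
      show "0 = \<phi> s I" if "s \<in> T" for s
        using G2[OF that] False by (simp add: G2_form_def is_form_def has_degree_def)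
    qed
    moreover have "\<gamma> s I = 0" for s
      unfolding \<gamma>_def pullback_def using False by (intro sum.neutral) (simp add: model_3form_degree)
    ultimately show ?thesis
      by (intro tangentI[of _ _ _ 0]) (simp_all add: \<phi>t \<gamma>_def)
  qed
  let ?J = "[i, j, k, l]"
  obtain g \<epsilon> where "G2_induces (\<phi> t) g \<epsilon>" using ind[OF t] by blast
  from tangent_gram_dual[OF tan this, of ?J] obtain E
    where E: "((\<lambda>s. gram_dual (\<phi> s) ?J) has_real_derivative E) (at t within T)"
      "((\<lambda>s. gram_dual (\<gamma> s) ?J) has_real_derivative E) (at t)"
    by (auto simp: tangent_def)
  \<comment> \<open>The explicit formula agrees with the dual form at all times in \<open>T\<close>,
    which suffices for a derivative within \<open>T\<close>.\<close>
  have "((\<lambda>s. G2_dual (\<phi> s) ?J) has_real_derivative E) (at t within T)"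
    by (rule has_field_derivative_transform_within[OF E(1) zero_less_one t])
       (use ind G2_dual_eq_gram_dual(1) in metis)
  moreover have "E = act N (pullback A model_4form) ?J + pullback A (act H model_4form) ?J"
  proof -
    have "continuous (at t) (\<lambda>s. det (A + (s - t) *\<^sub>R K))"
      unfolding det_def by (intro continuous_intros)
    moreover have "det (A + (t - t) *\<^sub>R K) \<noteq> 0" using A by (simp add: invertible_det_nz)
    ultimately have "\<forall>\<^sub>F s in at t. det (A + (s - t) *\<^sub>R K) \<noteq> 0"
      unfolding isCont_def by (rule tendsto_imp_eventually_ne)
    then have "\<forall>\<^sub>F s in nhds t. det (A + (s - t) *\<^sub>R K) \<noteq> 0"
      using A by (simp add: eventually_nhds_conv_at invertible_det_nz)
    then have "\<forall>\<^sub>F s in nhds t. gram_dual (\<gamma> s) ?J = pullback (A + (s - t) *\<^sub>R K) model_4form ?J"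
    proof eventually_elim
      case (elim s)
      then have inv: "invertible (A + (s - t) *\<^sub>R K)" by (simp add: invertible_det_nz)
      show ?case
        using G2_dual_eq_gram_dual(1)[OF G2_induces_pullback[OF inv], of ?J] G2_dual_pullback[OF inv, of ?J]
        by (simp add: \<gamma>_def)
    qed
    then have "((\<lambda>s. pullback (A + (s - t) *\<^sub>R K) model_4form ?J) has_real_derivative E) (at t)"
      using E(2) by (rule iffD1[OF DERIV_cong_ev[OF refl _ refl]])
    then show ?thesis by (rule DERIV_unique[OF _ D])
  qed
  moreover have "act N (pullback A model_4form) ?J
      = (\<Sum>m\<in>UNIV. M m i * G2_dual (\<phi> t) [m, j, k, l] + M m j * G2_dual (\<phi> t) [i, m, k, l]
                  + M m k * G2_dual (\<phi> t) [i, j, m, l] + M m l * G2_dual (\<phi> t) [i, j, k, m])"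
    by (simp add: act_Cons N_def \<psi>t sum.distrib)
  moreover have "pullback A (act H model_4form) ?J
      = - Z i * \<phi> t [j, k, l] + Z j * \<phi> t [i, k, l] - Z k * \<phi> t [i, j, l] + Z l * \<phi> t [i, j, k]"
  proof -
    \<comment> \<open>The expansion inserts \<open>i\<close> in the place of \<open>k\<close> or
      \<open>l\<close>; one or two adjacent swaps bring it to the front and give the alternating
      signs.\<close>
    have "\<phi> t [j, i, l] = - \<phi> t [i, j, l]" "\<phi> t [j, k, i] = \<phi> t [i, j, k]"
      using alternating_swap[OF alt, of "[]" j i "[l]"] alternating_swap[OF alt, of "[]" j i "[k]"]
        alternating_swap[OF alt, of "[j]" k i "[]"] by simp_all
    then show ?thesis
      unfolding H_def pullback_act_model_4form \<phi>t[symmetric] Z[symmetric]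
      by (simp add: lessThan_Suc numeral_eq_Suc)
  qed
  ultimately show ?thesis by (simp add: algebra_simps)
qed

theorem theorem3p5:
  fixes M :: "'a topology" and \<A> :: "('a, 7) chart set" and T :: "real set"
    and \<phi> h :: "real \<Rightarrow> ('a, 7) tensor_field" and X :: "real \<Rightarrow> ('a, 7) vec_field"
    and g :: "real \<Rightarrow> ('a, 7) chart \<Rightarrow> 'a \<Rightarrow> real^7^7" and \<psi> :: "real \<Rightarrow> ('a, 7) tensor_field"
  defines "g \<equiv> \<lambda>t c p. G2_metric (\<phi> t c p)"
    and "\<psi> \<equiv> \<lambda>t c p. G2_dual (\<phi> t c p)"
  assumes "smooth_manifold M \<A>"
    and "is_interval T" and "interior T \<noteq> {}"
    and "smooth_G2_family \<A> T \<phi>"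
    and "symmetric_2tensor_family \<A> T h"
    and "smooth_vec_family \<A> T X"
    and flow: "\<forall>t\<in>T. \<forall>c\<in>\<A>. \<forall>p\<in>fst c. \<forall>i j k.
      ((\<lambda>s. \<phi> s c p [i, j, k]) has_real_derivative
         (\<Sum>l\<in>UNIV. mixed (g t c p) (h t c p) l i * \<phi> t c p [l, j, k]
                  + mixed (g t c p) (h t c p) l j * \<phi> t c p [i, l, k]
                  + mixed (g t c p) (h t c p) l k * \<phi> t c p [i, j, l]
                  + X t c p $ l * \<psi> t c p [l, i, j, k])) (at t within T)"
  shows "\<forall>t\<in>T. \<forall>c\<in>\<A>. \<forall>p\<in>fst c. \<forall>i j k l.
      ((\<lambda>s. \<psi> s c p [i, j, k, l]) has_real_derivative
         (\<Sum>m\<in>UNIV. mixed (g t c p) (h t c p) m i * \<psi> t c p [m, j, k, l]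
                  + mixed (g t c p) (h t c p) m j * \<psi> t c p [i, m, k, l]
                  + mixed (g t c p) (h t c p) m k * \<psi> t c p [i, j, m, l]
                  + mixed (g t c p) (h t c p) m l * \<psi> t c p [i, j, k, m])
         - lower (g t c p) (X t c p) i * \<phi> t c p [j, k, l]
         + lower (g t c p) (X t c p) j * \<phi> t c p [i, k, l]
         - lower (g t c p) (X t c p) k * \<phi> t c p [i, j, l]
         + lower (g t c p) (X t c p) l * \<phi> t c p [i, j, k]) (at t within T)"
proof (intro ballI allI)
  \<comment> \<open>The equations contain no derivative in space, so each point can be treated
    separately in each chart.\<close>
  fix t c p i j k l assume t: "t \<in> T" and c: "c \<in> \<A>" and p: "p \<in> fst c"
  have G2: "G2_form (\<phi> s c p)" if "s \<in> T" for s
    using \<open>smooth_G2_family \<A> T \<phi>\<close> that c p by (simp add: smooth_G2_family_def)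
  show "((\<lambda>s. \<psi> s c p [i, j, k, l]) has_real_derivative
         (\<Sum>m\<in>UNIV. mixed (g t c p) (h t c p) m i * \<psi> t c p [m, j, k, l]
                  + mixed (g t c p) (h t c p) m j * \<psi> t c p [i, m, k, l]
                  + mixed (g t c p) (h t c p) m k * \<psi> t c p [i, j, m, l]
                  + mixed (g t c p) (h t c p) m l * \<psi> t c p [i, j, k, m])
         - lower (g t c p) (X t c p) i * \<phi> t c p [j, k, l]
         + lower (g t c p) (X t c p) j * \<phi> t c p [i, k, l]
         - lower (g t c p) (X t c p) k * \<phi> t c p [i, j, l]
         + lower (g t c p) (X t c p) l * \<phi> t c p [i, j, k]) (at t within T)"
    using flow t c p unfolding g_def \<psi>_def
    by (intro dual_derivative[of T "\<lambda>s. \<phi> s c p"] G2) auto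
qed

end
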